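(* Let $\Gamma$ be a simplicial set with geometric realization $|\Gamma|$. For $m\ge 0$, $g\in U(\tilde{\mathcal S})(m)=\tilde{\mathcal S}(1,m)$, $\gamma\in\Gamma_d$ and $\mathbf x\in\mathbf\Delta^d$, the formula $$U(\Phi)\big(g,(\gamma,\mathbf x)\big)=\big((\gamma,\pi_1\Phi(g,\mathbf x)),\dots,(\gamma,\pi_m\Phi(g,\mathbf x))\big)$$ gives well-defined maps $U(\tilde{\mathcal S})(m)\times|\Gamma|\to|\Gamma|^m$, and these define a $U(\tilde{\mathcal S})$-coalgebra structure on $|\Gamma|$, natural in the simplicial set $\Gamma$. Here $\Phi$ denotes the $\tilde{\mathcal S}$-bialgebra structure on $\mathbf\Delta^d$ described in the context and $\pi_i:(\mathbf\Delta^d)^m\to\mathbf\Delta^d$ is the $i$-th projection.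
   Context: Work in the symmetric monoidal category $(\mathrm{CW},\times,\mathbf 1)$ of CW-complexes and CW-maps (cellular maps), $\mathbf 1$ being a single $0$-cell; $\mathrm I=[0,1]$ with its usual CW-structure. Props. A prop $\mathcal P$ is a strict symmetric monoidal category enriched in CW generated by a single object $p$. Put $\mathcal P(n,m)=\mathrm{Hom}(p^{\odot n},p^{\odot m})$ ($n$ inputs, $m$ outputs), with commuting right $\Sigma_n$- and left $\Sigma_m$-actions, horizontal compositions $\odot$, vertical compositions $\circ$, and units. The operad $U(\mathcal P)$ is $\{\mathcal P(1,m)\}_{m\ge0}$ with the induced operad structure. A $\mathcal P$-bialgebra structure on a CW-complex $X$ is a collection of CW-maps $\mathcal P(n,m)\times X^n\to X^m$ satisfying the associativity, equivariance and unitality relations. For an operad $\mathcal O$, an $\mathcal O$-coalgebra structure on $X$ is a collection of CW-maps $\mathcal O(m)\times X\to X^m$, $m\ge0$, satisfying the associativity, equivariance and unitality relations. Presentations. The free prop on a $\Sigma$-bimodule $\mathcal B$ consists of isomorphism classes of finite directed graphs without directed loops, with labeled external incoming and outgoing half-edges and labeled half-edges at each vertex, vertices being decorated by elements of $\mathcal B$, modulo compatibility of decorations with relabeling. A prop presented by generating cells (copies of $\mathrm I^d$ in given biarities), attaching maps and relations is obtained from the free prop on the generating $0$-cells by successively attaching the generating $d$-cells via pushouts of props along the attaching maps, then taking the quotient by the smallest identification containing the relations and closed under symmetric group actions and compositions. The prop $\tilde{\mathcal S}$ has generating cells: a $0$-cell $\varepsilon\in\tilde{\mathcal S}(1,0)$;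 a $0$-cell $\Delta\in\tilde{\mathcal S}(1,2)$; a $1$-cell $\{\mu_s\}_{s\in\mathrm I}$ in $\tilde{\mathcal S}(2,1)$; a $1$-cell $\{h_s\}_{s\in \mathrm I}$ in $\tilde{\mathcal S}(1,1)$. Attaching maps: $\mu_0=\mathrm{id}\odot\varepsilon$, $\mu_1=\varepsilon\odot\mathrm{id}$, $h_0=\mathrm{id}$, $h_1=(\varepsilon\odot\mathrm{id})\circ\Delta$. Relations (for all $s\in\mathrm I$): $(\varepsilon\odot\varepsilon)\circ\Delta=\varepsilon$, $\varepsilon\circ\mu_s=\varepsilon\odot\varepsilon$, $\varepsilon\circ h_s=\varepsilon$. Simplices. $\mathbf\Delta^0=\{0\}$ (regarded as the space of empty tuples) and, for $d\ge1$, $\mathbf\Delta^d=\{(x_1,\dots,x_d)\in\mathrm I^d : x_1\le\cdots\le x_d\}$. The coface maps $\delta_i:\mathbf\Delta^d\to\mathbf\Delta^{d+1}$, $0\le i\le d+1$, are $\delta_0(x_1,\dots,x_d)=(0,x_1,\dots,x_d)$, $\delta_i(x_1,\dots,x_d)=(x_1,\dots,x_i,x_i,\dots,x_d)$ for $0<i<d+1$, and $\delta_{d+1}(x_1,\dots,x_d)=(x_1,\dots,x_d,1)$. The codegeneracy maps $\sigma_i:\mathbf\Delta^{d+1}\to\mathbf\Delta^d$, $1\le i\le d+1$, omit the coordinate $x_i$. $\mathbf\Delta^d$ has the CW-structure in which $(x_1,\dots,x_d)$ lies in the $k$-skeleton iff $\{x_i : x_i\ne0,1\}$ has cardinality at most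 $k$. The simplex category is the subcategory of CW-complexes with objects the $\mathbf\Delta^d$ and morphisms generated by cofaces and codegeneracies. A simplicial set $\Gamma$ is a contravariant functor from the simplex category to sets; $\Gamma_d=\Gamma(\mathbf\Delta^d)$. Its geometric realization is the CW-complex $|\Gamma|=\coprod_{d\ge0}\Gamma_d\times\mathbf\Delta^d/\!\sim$, where $(\tau^*(\gamma),\mathbf x)\sim(\gamma,\tau(\mathbf x))$ for all $\tau\in\mathrm{Hom}(\mathbf\Delta^d,\mathbf\Delta^e)$, $\gamma\in\Gamma_e$, $\mathbf x\in\mathbf\Delta^d$. The $\tilde{\mathcal S}$-bialgebra structure $\Phi$ on $\mathbf\Delta^d$ (with $\Phi(g,-):(\mathbf\Delta^d)^n\to(\mathbf\Delta^d)^m$ for $g\in\tilde{\mathcal S}(n,m)$). For $x,y\in[0,1]$, $s\in\mathrm I$ put: $\Delta(x)=(0,2x)$ if $x\le1/2$ and $\Delta(x)=(2x-1,1)$ if $x\ge1/2$, with components $\pi_1\Delta(x),\pi_2\Delta(x)$; $\psi_s(x,y)=(1-s)x+sy$; $\phi_s(x)=\frac{2x}{2-s}$ if $x\le\frac{2-s}{2}$ and $\phi_s(x)=1$ if $x\ge\frac{2-s}2$. Then $\Phi$ is determined on generators by applying these coordinatewise: $\Phi(\Delta,(x_1,\dots,x_d))=\big((\pi_1\Delta(x_1),\dots,\pi_1\Delta(x_d)),(\pi_2\Delta(x_1),\dots,\pi_2\Delta(x_d))\big)$; $\Phi(\varepsilon,-)$ is the unique map $\mathbf\Delta^d\to(\mathbf\Delta^d)^0=\mathbf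 1$; $\Phi(\mu_s,(x_i),(y_i))=(\psi_s(x_1,y_1),\dots,\psi_s(x_d,y_d))$; $\Phi(h_s,(x_i))=(\phi_s(x_1),\dots,\phi_s(x_d))$. *)

theory Defs
  imports "HOL-Analysis.Analysis"
begin

section \<open>Spaces with skeleta and cellular maps\<close>

text \<open>
  A CW-complex is carried by its underlying space together with its skeletal filtration
  (the open cells are recovered as the components of the successive differences).
  Finite powers are indexed by \<open>{..<m}\<close>.  Products and powers carry the compactly generated
  product topology, which for CW-complexes is the weak topology of the product cells; the plain
  product topology is too coarse in general.
\<close>

record 'a cw =
  cw_top :: "'a topology"
  cw_skel :: "nat \<Rightarrow> 'a set"

abbreviation cw_points :: "'a cw \<Rightarrow> 'a set" where
  "cw_points X \<equiv> topspace (cw_top X)"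

definition cw_map :: "'a cw \<Rightarrow> 'b cw \<Rightarrow> ('a \<Rightarrow> 'b) \<Rightarrow> bool" where
  "cw_map X Y f \<longleftrightarrow>
     continuous_map (cw_top X) (cw_top Y) f \<and> (\<forall>k. f ` cw_skel X k \<subseteq> cw_skel Y k)"

definition cw_prod :: "'a cw \<Rightarrow> 'b cw \<Rightarrow> ('a \<times> 'b) cw" where
  "cw_prod X Y =
    \<lparr> cw_top = kification (prod_topology (cw_top X) (cw_top Y)),
      cw_skel = (\<lambda>k. \<Union>i\<le>k. cw_skel X i \<times> cw_skel Y (k - i)) \<rparr>"

definition cw_power :: "'a cw \<Rightarrow> nat \<Rightarrow> (nat \<Rightarrow> 'a) cw" where
  "cw_power X m =
    \<lparr> cw_top = kification (product_topology (\<lambda>_. cw_top X) {..<m}),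
      cw_skel = (\<lambda>k. \<Union>c \<in> {c. (\<Sum>i<m. c i) \<le> k}. \<Pi>\<^sub>E i\<in>{..<m}. cw_skel X (c i)) \<rparr>"

definition quotient_topology :: "'a topology \<Rightarrow> ('a \<Rightarrow> 'b) \<Rightarrow> 'b topology" where
  "quotient_topology X q =
     topology (\<lambda>U. U \<subseteq> q ` topspace X \<and> openin X {x \<in> topspace X. q x \<in> U})"

lemma openin_quotient_topology:
  "openin (quotient_topology X q) U \<longleftrightarrow>
     U \<subseteq> q ` topspace X \<and> openin X {x \<in> topspace X. q x \<in> U}"
proof -
  have "istopology (\<lambda>U. U \<subseteq> q ` topspace X \<and> openin X {x \<in> topspace X. q x \<in> U})"
    unfolding istopology_def
  proof (intro conjI allI impI)
    fix S T
    assume S: "S \<subseteq> q ` topspace X \<and> openin X {x \<in> topspace X. q x \<in> S}"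
      and T: "T \<subseteq> q ` topspace X \<and> openin X {x \<in> topspace X. q x \<in> T}"
    have "{x \<in> topspace X. q x \<in> S \<inter> T}
            = {x \<in> topspace X. q x \<in> S} \<inter> {x \<in> topspace X. q x \<in> T}"
      by auto
    then show "openin X {x \<in> topspace X. q x \<in> S \<inter> T}"
      using S T by auto
    show "S \<inter> T \<subseteq> q ` topspace X"
      using S by auto
  next
    fix \<K>
    assume K: "\<forall>K\<in>\<K>. K \<subseteq> q ` topspace X \<and> openin X {x \<in> topspace X. q x \<in> K}"
    have "{x \<in> topspace X. q x \<in> \<Union>\<K>} = (\<Union>K\<in>\<K>. {x \<in> topspace X. q x \<in> K})"
      by auto
    then show "openin X {x \<in> topspace X. q x \<in> \<Union>\<K>}"
      using K by auto
    show "\<Union>\<K> \<subseteq> q ` topspace X"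
      using K by auto
  qed
  then show ?thesis
    by (simp add: quotient_topology_def topology_inverse')
qed

section \<open>Props, operads and coalgebras\<close>

text \<open>
  The elements of a prop or operad are assumed to determine their arities, so the compositions
  take no arity arguments.  The composition \<open>pcomp P g f\<close> is \<open>g \<circ> f\<close>, and
  \<open>psym m \<sigma>\<close> in biarity \<open>(m, m)\<close> sends input \<open>i\<close> to output \<open>\<sigma> i\<close>, so that post-composition
  with it is the left action of the symmetric group.
\<close>

record 'p cw_prop =
  phom :: "nat \<Rightarrow> nat \<Rightarrow> 'p cw"
  pcomp :: "'p \<Rightarrow> 'p \<Rightarrow> 'p"
  ptimes :: "'p \<Rightarrow> 'p \<Rightarrow> 'p"
  pone :: "nat \<Rightarrow> 'p"
  psym :: "nat \<Rightarrow> (nat \<Rightarrow> nat) \<Rightarrow> 'p"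

record 'o cw_operad =
  osp :: "nat \<Rightarrow> 'o cw"
  ounit :: 'o
  ocomp :: "'o \<Rightarrow> 'o list \<Rightarrow> 'o"
  osym :: "nat \<Rightarrow> (nat \<Rightarrow> nat) \<Rightarrow> 'o \<Rightarrow> 'o"

definition U_operad :: "'p cw_prop \<Rightarrow> 'p cw_operad" where
  "U_operad P =
    \<lparr> osp = (\<lambda>m. phom P 1 m),
      ounit = pone P 1,
      ocomp = (\<lambda>g gs. pcomp P (foldr (ptimes P) gs (pone P 0)) g),
      osym = (\<lambda>m \<sigma> g. pcomp P (psym P m \<sigma>) g) \<rparr>"

text \<open>
  In the associativity relation the arities of the inner operations are \<open>ks\<close>, and coordinate \<open>j\<close>
  of the \<open>i\<close>-th block of the result is the coordinate with number \<open>sum_list (take i ks) + j\<close>.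
\<close>

definition coalgebra :: "'o cw_operad \<Rightarrow> 'x cw \<Rightarrow> (nat \<Rightarrow> 'o \<Rightarrow> 'x \<Rightarrow> nat \<Rightarrow> 'x) \<Rightarrow> bool" where
  "coalgebra Q X act \<longleftrightarrow>
     (\<forall>m. cw_map (cw_prod (osp Q m) X) (cw_power X m) (\<lambda>(g, x). act m g x)) \<and>
     (\<forall>m ks g gs x. length ks = m \<longrightarrow> length gs = m \<longrightarrow>
        g \<in> cw_points (osp Q m) \<longrightarrow> (\<forall>i<m. gs ! i \<in> cw_points (osp Q (ks ! i))) \<longrightarrow>
        x \<in> cw_points X \<longrightarrow>
        (\<forall>i<m. \<forall>j<ks ! i.
           act (sum_list ks) (ocomp Q g gs) x (sum_list (take i ks) + j)
             = act (ks ! i) (gs ! i) (act m g x i) j)) \<and>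
     (\<forall>m \<sigma> g x. \<sigma> permutes {..<m} \<longrightarrow> g \<in> cw_points (osp Q m) \<longrightarrow> x \<in> cw_points X \<longrightarrow>
        act m (osym Q m \<sigma> g) x = (\<lambda>j\<in>{..<m}. act m g x (inv \<sigma> j))) \<and>
     (\<forall>x \<in> cw_points X. act 1 (ounit Q) x = (\<lambda>j\<in>{..<1}. x))"

section \<open>Diagrams\<close>

text \<open>
  A diagram is a finite directed acyclic graph whose vertices are decorated by the generators.
  An edge joins a target half-edge to a source half-edge: sources are the external inputs and the
  outputs of vertices, targets are the external outputs and the inputs of vertices, and
  \<open>sh_wire\<close> is the resulting bijection from targets to sources.  Numbering the half-edges at a
  vertex in the standard way picks one representative of each decoration modulo relabeling.
  The parameters in \<open>I\<close> of the vertices decorated by 1-cells are kept apart from the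
  combinatorial part, being the coordinates of the cells.
\<close>

datatype gen = GEps | GDelta | GMu | GH

fun gen_in :: "gen \<Rightarrow> nat" where
  "gen_in GEps = 1" | "gen_in GDelta = 1" | "gen_in GMu = 2" | "gen_in GH = 1"

fun gen_out :: "gen \<Rightarrow> nat" where
  "gen_out GEps = 0" | "gen_out GDelta = 2" | "gen_out GMu = 1" | "gen_out GH = 1"

fun gen_dim :: "gen \<Rightarrow> nat" where
  "gen_dim GEps = 0" | "gen_dim GDelta = 0" | "gen_dim GMu = 1" | "gen_dim GH = 1"

datatype source = ExtIn nat | VertOut nat nat
datatype target = ExtOut nat | VertIn nat nat

record shape =
  sh_in :: nat
  sh_out :: nat
  sh_verts :: "nat set"
  sh_gen :: "nat \<Rightarrow> gen"
  sh_wire :: "target \<Rightarrow> source"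

type_synonym diagram = "shape \<times> (nat \<Rightarrow> real)"

definition sources :: "shape \<Rightarrow> source set" where
  "sources S = ExtIn ` {..<sh_in S} \<union>
     {VertOut v j | v j. v \<in> sh_verts S \<and> j < gen_out (sh_gen S v)}"

definition targets :: "shape \<Rightarrow> target set" where
  "targets S = ExtOut ` {..<sh_out S} \<union>
     {VertIn v i | v i. v \<in> sh_verts S \<and> i < gen_in (sh_gen S v)}"

definition edges :: "shape \<Rightarrow> (nat \<times> nat) set" where
  "edges S = {(u, v). u \<in> sh_verts S \<and> v \<in> sh_verts S \<and>
     (\<exists>i<gen_in (sh_gen S v). \<exists>j. sh_wire S (VertIn v i) = VertOut u j)}"

definition shapes :: "nat \<Rightarrow> nat \<Rightarrow> shape set" where
  "shapes n m = {S. sh_in S = n \<and> sh_out S = m \<and> finite (sh_verts S) \<and>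
     bij_betw (sh_wire S) (targets S) (sources S) \<and> acyclic (edges S)}"

definition cell_verts :: "shape \<Rightarrow> nat set" where
  "cell_verts S = {v \<in> sh_verts S. gen_dim (sh_gen S v) = 1}"

definition params :: "shape \<Rightarrow> (nat \<Rightarrow> real) set" where
  "params S = (\<Pi>\<^sub>E v\<in>cell_verts S. {0..1})"

definition diagrams :: "nat \<Rightarrow> nat \<Rightarrow> diagram set" where
  "diagrams n m = {(S, p). S \<in> shapes n m \<and> p \<in> params S}"

fun map_source :: "(nat \<Rightarrow> nat) \<Rightarrow> (nat \<Rightarrow> nat) \<Rightarrow> source \<Rightarrow> source" where
  "map_source e f (ExtIn i) = ExtIn (e i)"
| "map_source e f (VertOut v j) = VertOut (f v) j"

fun map_target :: "(nat \<Rightarrow> nat) \<Rightarrow> target \<Rightarrow> target" where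
  "map_target f (ExtOut j) = ExtOut j"
| "map_target f (VertIn v i) = VertIn (f v) i"

definition diagram_iso :: "(nat \<Rightarrow> nat) \<Rightarrow> diagram \<Rightarrow> diagram \<Rightarrow> bool" where
  "diagram_iso f D E \<longleftrightarrow>
     sh_in (fst D) = sh_in (fst E) \<and> sh_out (fst D) = sh_out (fst E) \<and>
     bij_betw f (sh_verts (fst D)) (sh_verts (fst E)) \<and>
     (\<forall>v \<in> sh_verts (fst D). sh_gen (fst E) (f v) = sh_gen (fst D) v) \<and>
     (\<forall>v \<in> cell_verts (fst D). snd E (f v) = snd D v) \<and>
     (\<forall>t \<in> targets (fst D).
        sh_wire (fst E) (map_target f t) = map_source id f (sh_wire (fst D) t))"

definition d_perm :: "nat \<Rightarrow> (nat \<Rightarrow> nat) \<Rightarrow> diagram" where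
  "d_perm m \<sigma> =
    (\<lparr> sh_in = m, sh_out = m, sh_verts = {}, sh_gen = (\<lambda>_. GEps),
       sh_wire = (\<lambda>t. case t of ExtOut j \<Rightarrow> ExtIn (inv \<sigma> j) | VertIn v i \<Rightarrow> ExtIn i) \<rparr>,
     \<lambda>v\<in>{}. 0)"

abbreviation d_id :: "nat \<Rightarrow> diagram" where
  "d_id n \<equiv> d_perm n id"

text \<open>The single-vertex diagram; the parameter is irrelevant for the 0-cells.\<close>

definition d_gen :: "gen \<Rightarrow> real \<Rightarrow> diagram" where
  "d_gen a s =
    (\<lparr> sh_in = gen_in a, sh_out = gen_out a, sh_verts = {0}, sh_gen = (\<lambda>_. a),
       sh_wire = (\<lambda>t. case t of ExtOut j \<Rightarrow> VertOut 0 j | VertIn v i \<Rightarrow> ExtIn i) \<rparr>,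
     \<lambda>v\<in>{v \<in> {0}. gen_dim a = 1}. s)"

text \<open>
  In both compositions the vertices of the first-applied (respectively left) diagram are renamed
  to even numbers and those of the other one to odd numbers.
\<close>

definition join_verts :: "shape \<Rightarrow> shape \<Rightarrow> nat set" where
  "join_verts F G = (\<lambda>v. 2 * v) ` sh_verts F \<union> (\<lambda>v. 2 * v + 1) ` sh_verts G"

definition join_gen :: "shape \<Rightarrow> shape \<Rightarrow> nat \<Rightarrow> gen" where
  "join_gen F G w = (if even w then sh_gen F (w div 2) else sh_gen G (w div 2))"

definition join_params :: "diagram \<Rightarrow> diagram \<Rightarrow> nat \<Rightarrow> real" where
  "join_params D E = (\<lambda>w \<in> (\<lambda>v. 2 * v) ` cell_verts (fst D) \<union> (\<lambda>v. 2 * v + 1) ` cell_verts (fst E).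
     if even w then snd D (w div 2) else snd E (w div 2))"

text \<open>\<open>shape_comp G F\<close> is \<open>G \<circ> F\<close>: the external inputs of \<open>G\<close> are spliced with the external
  outputs of \<open>F\<close>.\<close>

definition splice :: "shape \<Rightarrow> source \<Rightarrow> source" where
  "splice F s = (case s of
      ExtIn i \<Rightarrow> map_source id (\<lambda>v. 2 * v) (sh_wire F (ExtOut i))
    | VertOut v j \<Rightarrow> VertOut (2 * v + 1) j)"

definition shape_comp :: "shape \<Rightarrow> shape \<Rightarrow> shape" where
  "shape_comp G F =
    \<lparr> sh_in = sh_in F, sh_out = sh_out G, sh_verts = join_verts F G, sh_gen = join_gen F G,
      sh_wire = (\<lambda>t. case t of
          ExtOut j \<Rightarrow> splice F (sh_wire G (ExtOut j))
        | VertIn w i \<Rightarrow>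
            if even w then map_source id (\<lambda>v. 2 * v) (sh_wire F (VertIn (w div 2) i))
            else splice F (sh_wire G (VertIn (w div 2) i))) \<rparr>"

definition shape_times :: "shape \<Rightarrow> shape \<Rightarrow> shape" where
  "shape_times F G =
    \<lparr> sh_in = sh_in F + sh_in G, sh_out = sh_out F + sh_out G,
      sh_verts = join_verts F G, sh_gen = join_gen F G,
      sh_wire = (\<lambda>t.
        let left = map_source id (\<lambda>v. 2 * v);
            right = map_source (\<lambda>i. sh_in F + i) (\<lambda>v. 2 * v + 1)
        in case t of
          ExtOut j \<Rightarrow>
            if j < sh_out F then left (sh_wire F (ExtOut j))
            else right (sh_wire G (ExtOut (j - sh_out F)))
        | VertIn w i \<Rightarrow>
            if even w then left (sh_wire F (VertIn (w div 2) i))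
            else right (sh_wire G (VertIn (w div 2) i))) \<rparr>"

definition d_comp :: "diagram \<Rightarrow> diagram \<Rightarrow> diagram" where
  "d_comp E D = (shape_comp (fst E) (fst D), join_params D E)"

definition d_times :: "diagram \<Rightarrow> diagram \<Rightarrow> diagram" where
  "d_times D E = (shape_times (fst D) (fst E), join_params D E)"

section \<open>The prop\<close>

abbreviation d_eps :: diagram where "d_eps \<equiv> d_gen GEps 0"
abbreviation d_delta :: diagram where "d_delta \<equiv> d_gen GDelta 0"
abbreviation d_mu :: "real \<Rightarrow> diagram" where "d_mu s \<equiv> d_gen GMu s"
abbreviation d_h :: "real \<Rightarrow> diagram" where "d_h s \<equiv> d_gen GH s"

text \<open>
  Isomorphism of diagrams (the free prop), the identifications made by attaching the 1-cells,
  and the relations, closed under the compositions.  Symmetric group actions are compositions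
  with the diagrams \<open>d_perm\<close>.
\<close>

inductive st_eq :: "diagram \<Rightarrow> diagram \<Rightarrow> bool" where
  iso: "D \<in> diagrams n m \<Longrightarrow> E \<in> diagrams n m \<Longrightarrow> diagram_iso f D E \<Longrightarrow> st_eq D E"
| sym: "st_eq D E \<Longrightarrow> st_eq E D"
| trans: "st_eq C D \<Longrightarrow> st_eq D E \<Longrightarrow> st_eq C E"
| comp: "st_eq E E' \<Longrightarrow> st_eq D D' \<Longrightarrow> sh_in (fst E) = sh_out (fst D) \<Longrightarrow>
    st_eq (d_comp E D) (d_comp E' D')"
| times: "st_eq D D' \<Longrightarrow> st_eq E E' \<Longrightarrow> st_eq (d_times D E) (d_times D' E')"
| mu_0: "st_eq (d_mu 0) (d_times (d_id 1) d_eps)"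
| mu_1: "st_eq (d_mu 1) (d_times d_eps (d_id 1))"
| h_0: "st_eq (d_h 0) (d_id 1)"
| h_1: "st_eq (d_h 1) (d_comp (d_times d_eps (d_id 1)) d_delta)"
| eps_delta: "st_eq (d_comp (d_times d_eps d_eps) d_delta) d_eps"
| eps_mu: "s \<in> {0..1} \<Longrightarrow> st_eq (d_comp d_eps (d_mu s)) (d_times d_eps d_eps)"
| eps_h: "s \<in> {0..1} \<Longrightarrow> st_eq (d_comp d_eps (d_h s)) d_eps"

definition st_class :: "diagram \<Rightarrow> diagram set" where
  "st_class D = {E. st_eq D E}"

text \<open>
  The hom-spaces have the quotient topology from the disjoint union of the parameter cubes of all
  shapes; the \<open>k\<close>-skeleton consists of the classes of diagrams with at most \<open>k\<close> vertices
  decorated by 1-cells.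
\<close>

definition st_hom :: "nat \<Rightarrow> nat \<Rightarrow> diagram set cw" where
  "st_hom n m =
    \<lparr> cw_top = quotient_topology
        (sum_topology (\<lambda>S. subtopology (powertop_real (cell_verts S)) (params S)) (shapes n m))
        st_class,
      cw_skel = (\<lambda>k. {st_class D | D. D \<in> diagrams n m \<and> card (cell_verts (fst D)) \<le> k}) \<rparr>"

definition St :: "diagram set cw_prop" where
  "St =
    \<lparr> phom = st_hom,
      pcomp = (\<lambda>B A. \<Union>E\<in>B. \<Union>D\<in>A. st_class (d_comp E D)),
      ptimes = (\<lambda>A B. \<Union>D\<in>A. \<Union>E\<in>B. st_class (d_times D E)),
      pone = (\<lambda>n. st_class (d_id n)),
      psym = (\<lambda>m \<sigma>. st_class (d_perm m \<sigma>)) \<rparr>"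

section \<open>Simplices, simplicial sets and geometric realization\<close>

text \<open>Points of the \<open>d\<close>-simplex are extensional functions on \<open>{1..d}\<close>.\<close>

type_synonym point = "nat \<Rightarrow> real"

definition simplex_pts :: "nat \<Rightarrow> point set" where
  "simplex_pts d = {x \<in> (\<Pi>\<^sub>E i\<in>{1..d}. {0..1}). \<forall>i\<in>{1..d}. \<forall>j\<in>{1..d}. i \<le> j \<longrightarrow> x i \<le> x j}"

definition simplex_cw :: "nat \<Rightarrow> point cw" where
  "simplex_cw d =
    \<lparr> cw_top = subtopology (powertop_real {1..d}) (simplex_pts d),
      cw_skel = (\<lambda>k. {x \<in> simplex_pts d. card (x ` {1..d} - {0, 1}) \<le> k}) \<rparr>"

definition coface :: "nat \<Rightarrow> nat \<Rightarrow> point \<Rightarrow> point" where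
  "coface d i = (\<lambda>x \<in> simplex_pts d. \<lambda>j \<in> {1..d + 1}.
     if i = 0 then (if j = 1 then 0 else x (j - 1))
     else if i = d + 1 then (if j = d + 1 then 1 else x j)
     else (if j \<le> i then x j else x (j - 1)))"

definition codegeneracy :: "nat \<Rightarrow> nat \<Rightarrow> point \<Rightarrow> point" where
  "codegeneracy d i = (\<lambda>x \<in> simplex_pts (d + 1). \<lambda>j \<in> {1..d}.
     if j < i then x j else x (j + 1))"

inductive simplex_hom :: "nat \<Rightarrow> nat \<Rightarrow> (point \<Rightarrow> point) \<Rightarrow> bool" where
  ident: "simplex_hom d d (\<lambda>x \<in> simplex_pts d. x)"
| coface: "simplex_hom c d f \<Longrightarrow> i \<le> d + 1 \<Longrightarrow>
    simplex_hom c (d + 1) (compose (simplex_pts c) (coface d i) f)"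
| codegeneracy: "simplex_hom c (d + 1) f \<Longrightarrow> 1 \<le> i \<Longrightarrow> i \<le> d + 1 \<Longrightarrow>
    simplex_hom c d (compose (simplex_pts c) (codegeneracy d i) f)"

text \<open>\<open>s_pull d e \<tau>\<close> is the map \<open>\<tau>\<^sup>*\<close> induced by a morphism from the \<open>d\<close>-simplex to the
  \<open>e\<close>-simplex.\<close>

record 'g sset =
  s_cells :: "nat \<Rightarrow> 'g set"
  s_pull :: "nat \<Rightarrow> nat \<Rightarrow> (point \<Rightarrow> point) \<Rightarrow> 'g \<Rightarrow> 'g"

definition simplicial_set :: "'g sset \<Rightarrow> bool" where
  "simplicial_set \<Gamma> \<longleftrightarrow>
     (\<forall>d e \<tau>. simplex_hom d e \<tau> \<longrightarrow> s_pull \<Gamma> d e \<tau> \<in> s_cells \<Gamma> e \<rightarrow> s_cells \<Gamma> d) \<and>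
     (\<forall>d. \<forall>\<gamma> \<in> s_cells \<Gamma> d. s_pull \<Gamma> d d (\<lambda>x \<in> simplex_pts d. x) \<gamma> = \<gamma>) \<and>
     (\<forall>c d e \<rho> \<tau>. simplex_hom c d \<rho> \<longrightarrow> simplex_hom d e \<tau> \<longrightarrow>
        (\<forall>\<gamma> \<in> s_cells \<Gamma> e.
           s_pull \<Gamma> c e (compose (simplex_pts c) \<tau> \<rho>) \<gamma> = s_pull \<Gamma> c d \<rho> (s_pull \<Gamma> d e \<tau> \<gamma>)))"

definition simplicial_map :: "'g sset \<Rightarrow> 'h sset \<Rightarrow> (nat \<Rightarrow> 'g \<Rightarrow> 'h) \<Rightarrow> bool" where
  "simplicial_map \<Gamma> \<Gamma>' F \<longleftrightarrow>
     (\<forall>d. F d \<in> s_cells \<Gamma> d \<rightarrow> s_cells \<Gamma>' d) \<and>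
     (\<forall>d e \<tau>. simplex_hom d e \<tau> \<longrightarrow>
        (\<forall>\<gamma> \<in> s_cells \<Gamma> e. F d (s_pull \<Gamma> d e \<tau> \<gamma>) = s_pull \<Gamma>' d e \<tau> (F e \<gamma>)))"

type_synonym 'g gpoint = "(nat \<times> 'g) \<times> point"

definition glue :: "'g sset \<Rightarrow> 'g gpoint \<Rightarrow> 'g gpoint \<Rightarrow> bool" where
  "glue \<Gamma> a b \<longleftrightarrow> (\<exists>d e \<tau> \<gamma> x. simplex_hom d e \<tau> \<and> \<gamma> \<in> s_cells \<Gamma> e \<and> x \<in> simplex_pts d \<and>
     a = ((d, s_pull \<Gamma> d e \<tau> \<gamma>), x) \<and> b = ((e, \<gamma>), \<tau> x))"

definition geom_class :: "'g sset \<Rightarrow> 'g gpoint \<Rightarrow> 'g gpoint set" where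
  "geom_class \<Gamma> a = {b. equivclp (glue \<Gamma>) a b}"

definition geom :: "'g sset \<Rightarrow> 'g gpoint set cw" where
  "geom \<Gamma> =
    \<lparr> cw_top = quotient_topology
        (sum_topology (\<lambda>(d, \<gamma>). cw_top (simplex_cw d)) (SIGMA d:UNIV. s_cells \<Gamma> d))
        (geom_class \<Gamma>),
      cw_skel = (\<lambda>k. {geom_class \<Gamma> ((d, \<gamma>), x) | d \<gamma> x.
         \<gamma> \<in> s_cells \<Gamma> d \<and> x \<in> cw_skel (simplex_cw d) k}) \<rparr>"

definition geom_map :: "'h sset \<Rightarrow> (nat \<Rightarrow> 'g \<Rightarrow> 'h) \<Rightarrow> 'g gpoint set \<Rightarrow> 'h gpoint set" where
  "geom_map \<Gamma>' F c = (\<Union>((d, \<gamma>), x) \<in> c. geom_class \<Gamma>' ((d, F d \<gamma>), x))"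

section \<open>The action on simplices and on geometric realizations\<close>

definition pi1_Delta :: "real \<Rightarrow> real" where
  "pi1_Delta x = (if x \<le> 1/2 then 0 else 2 * x - 1)"

definition pi2_Delta :: "real \<Rightarrow> real" where
  "pi2_Delta x = (if x \<le> 1/2 then 2 * x else 1)"

definition psi :: "real \<Rightarrow> real \<Rightarrow> real \<Rightarrow> real" where
  "psi s x y = (1 - s) * x + s * y"

definition phi :: "real \<Rightarrow> real \<Rightarrow> real" where
  "phi s x = (if x \<le> (2 - s) / 2 then 2 * x / (2 - s) else 1)"

text \<open>\<open>gen_act d a s xs j\<close> is the output number \<open>j\<close> of the generator \<open>a\<close> (with parameter \<open>s\<close>)
  applied to the inputs \<open>xs\<close> in the \<open>d\<close>-simplex.\<close>

fun gen_act :: "nat \<Rightarrow> gen \<Rightarrow> real \<Rightarrow> (nat \<Rightarrow> point) \<Rightarrow> nat \<Rightarrow> point" where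
  "gen_act d GEps s xs j = undefined"
| "gen_act d GDelta s xs j =
     (\<lambda>k\<in>{1..d}. if j = 0 then pi1_Delta (xs 0 k) else pi2_Delta (xs 0 k))"
| "gen_act d GMu s xs j = (\<lambda>k\<in>{1..d}. psi s (xs 0 k) (xs 1 k))"
| "gen_act d GH s xs j = (\<lambda>k\<in>{1..d}. phi s (xs 0 k))"

text \<open>
  A diagram acts by propagating the inputs along its edges through the generators at its vertices:
  \<open>v\<close> assigns to every edge (named by its source) the point it carries.
\<close>

definition valuation :: "nat \<Rightarrow> diagram \<Rightarrow> (nat \<Rightarrow> point) \<Rightarrow> (source \<Rightarrow> point) \<Rightarrow> bool" where
  "valuation d D xs v \<longleftrightarrow>
     (\<forall>i<sh_in (fst D). v (ExtIn i) = xs i) \<and>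
     (\<forall>u\<in>sh_verts (fst D). \<forall>j<gen_out (sh_gen (fst D) u).
        v (VertOut u j) =
          gen_act d (sh_gen (fst D) u) (snd D u) (\<lambda>i. v (sh_wire (fst D) (VertIn u i))) j)"

definition Phi :: "nat \<Rightarrow> diagram set \<Rightarrow> (nat \<Rightarrow> point) \<Rightarrow> nat \<Rightarrow> point" where
  "Phi d g xs = (THE ys. \<exists>D\<in>g. \<exists>v. valuation d D xs v \<and>
     ys = (\<lambda>j\<in>{..<sh_out (fst D)}. v (sh_wire (fst D) (ExtOut j))))"

text \<open>The operation induced on the realization by evaluating the formula on representatives;
  an element of biarity \<open>(1, m)\<close> is applied to the one-element family with entry \<open>x\<close>.\<close>

definition U_Phi :: "'g sset \<Rightarrow> nat \<Rightarrow> diagram set \<Rightarrow> 'g gpoint set \<Rightarrow> nat \<Rightarrow> 'g gpoint set" where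
  "U_Phi \<Gamma> m g c = (THE ys. \<exists>d \<gamma> x. ((d, \<gamma>), x) \<in> c \<and>
     ys = (\<lambda>i\<in>{..<m}. geom_class \<Gamma> ((d, \<gamma>), Phi d g (\<lambda>j\<in>{..<1}. x) i)))"

end

(*
  Every generator acts on a point of a simplex by applying one and the same operation to each
  coordinate, so an element g of biarity (1, m) acts through m nondecreasing maps of the unit
  interval that fix 0 and 1 (its profiles).  Such maps commute with all cofaces and codegeneracies,
  which makes the action on the realization well defined, and the relations of a coalgebra reduce to
  identities between scalar functions.  Since these identities hold for all diagrams related by
  st_eq, composites of diagrams never have to be shown to be acyclic.

  Continuity on the k-ified product avoids any separation property of the hom-spaces: the action
  factors through the profiles, and a compact set of elements g has a compact image in the metric
  space of bounded continuous functions.  The product of that image with the quotient map defining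
  the realization is again a quotient map.
*)

theory Submission
  imports Defs
begin

subsection \<open>Coordinatewise evaluation of diagrams\<close>

text \<open>Two matters shape the work beyond the overview. The first is cellularity, which is a
  count: the skeleton containing a point of a simplex is determined by the number of its distinct
  coordinates other than 0 and 1, and this number, summed over all outputs, has to be bounded. The
  bound is proved at each vertex and added up over the graph. The critical generator is
  \<open>GMu\<close>, where two points with a and b interior values might seem to produce about a b
  values. But both points are nondecreasing in the same index, so the pairs of coordinates form a
  chain in a grid with sides a + 2 and b + 2; such a chain has at most a + b + 3 members, and the
  two extreme corners give the values 0 and 1. The second is that compactness of a set of profiles
  is taken in the supremum metric, so dependence on the parameters must be controlled uniformly in
  the argument. Hence the Lipschitz estimates, whose constant depends only on the shape and the
  edge.\<close>

fun gen_fun :: "gen \<Rightarrow> real \<Rightarrow> (nat \<Rightarrow> real) \<Rightarrow> nat \<Rightarrow> real" where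
  "gen_fun GEps s xs j = 0"
| "gen_fun GDelta s xs j = (if j = 0 then pi1_Delta (xs 0) else pi2_Delta (xs 0))"
| "gen_fun GMu s xs j = psi s (xs 0) (xs 1)"
| "gen_fun GH s xs j = phi s (xs 0)"

lemma gen_act_eq_gen_fun:
  "j < gen_out a \<Longrightarrow> gen_act d a s xs j = (\<lambda>k\<in>{1..d}. gen_fun a s (\<lambda>i. xs i k) j)"
  by (cases a) auto

text \<open>Only the vertices of dimension 1 have a specified parameter, so equality of parameters
  is asked only there; \<open>diagram_iso\<close> and \<open>join_params\<close> preserve no
  more.\<close>

lemma gen_fun_cong:
  assumes "gen_dim a = 1 \<Longrightarrow> s = s'" "\<And>i. i < gen_in a \<Longrightarrow> xs i = ys i"
  shows "gen_fun a s xs j = gen_fun a s' ys j"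
  using assms by (cases a) auto

lemma psi_unit:
  assumes "s \<in> {0..1}" "x \<in> {0..1}" "y \<in> {0..1}"
  shows "psi s x y \<in> {0..1}"
proof -
  have "0 \<le> (1 - s) * x" "0 \<le> s * y" "(1 - s) * x \<le> (1 - s) * 1" "s * y \<le> s * 1"
    using assms by (auto intro!: mult_left_mono mult_nonneg_nonneg simp del: mult_1_right)
  then show ?thesis by (auto simp: psi_def)
qed

lemma psi_mono:
  assumes "s \<in> {0..1}" "x \<le> x'" "y \<le> y'"
  shows "psi s x y \<le> psi s x' y'"
  using assms unfolding psi_def by (intro add_mono mult_left_mono) auto

text \<open>The cut-off (2 - s) / 2 is where 2 x / (2 - s) reaches 1. In this form monotonicity and
  the Lipschitz bound follow from those of \<open>min 1\<close>.\<close>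

lemma phi_eq_min:
  assumes "s \<in> {0..1}"
  shows "phi s x = min 1 (2 * x / (2 - s))"
proof -
  have "2 - s > 0" using assms by auto
  then show ?thesis by (auto simp: phi_def min_def field_simps)
qed

lemma phi_unit:
  assumes "s \<in> {0..1}" "x \<in> {0..1}"
  shows "phi s x \<in> {0..1}"
  using assms by (auto simp: phi_eq_min)

lemma phi_mono:
  assumes "s \<in> {0..1}" "x \<le> y"
  shows "phi s x \<le> phi s y"
proof -
  have "2 * x / (2 - s) \<le> 2 * y / (2 - s)" using assms by (intro divide_right_mono) auto
  then show ?thesis using assms(1) by (simp add: phi_eq_min min_le_iff_disj)
qed

lemma gen_fun_unit:
  assumes "gen_dim a = 1 \<Longrightarrow> s \<in> {0..1}" "\<And>i. i < gen_in a \<Longrightarrow> xs i \<in> {0..1}"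
  shows "gen_fun a s xs j \<in> {0..1}"
proof (cases a)
  case GMu then show ?thesis using assms by (simp add: psi_unit del: atLeastAtMost_iff)
next
  case GH then show ?thesis using assms by (simp add: phi_unit del: atLeastAtMost_iff)
qed (use assms in \<open>auto simp: pi1_Delta_def pi2_Delta_def\<close>)

lemma gen_fun_mono:
  assumes "gen_dim a = 1 \<Longrightarrow> s \<in> {0..1}" "\<And>i. i < gen_in a \<Longrightarrow> xs i \<le> ys i"
  shows "gen_fun a s xs j \<le> gen_fun a s ys j"
proof (cases a)
  case GDelta
  have "xs 0 \<le> ys 0" using assms GDelta by auto
  then show ?thesis using GDelta by (auto simp: pi1_Delta_def pi2_Delta_def)
qed (use assms in \<open>auto intro!: psi_mono phi_mono\<close>)

lemma gen_fun_zero: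
  assumes "gen_dim a = 1 \<Longrightarrow> s \<in> {0..1}" "\<And>i. i < gen_in a \<Longrightarrow> xs i = 0"
  shows "gen_fun a s xs j = 0"
  using assms by (cases a) (auto simp: pi1_Delta_def pi2_Delta_def psi_def phi_eq_min)

text \<open>The bound on \<open>j\<close> excludes \<open>GEps\<close>, which has no output: its
  default value 0 agrees with the preceding lemmas but not with this one.\<close>

lemma gen_fun_one:
  assumes "gen_dim a = 1 \<Longrightarrow> s \<in> {0..1}" "j < gen_out a" "\<And>i. i < gen_in a \<Longrightarrow> xs i = 1"
  shows "gen_fun a s xs j = 1"
  using assms by (cases a) (auto simp: pi1_Delta_def pi2_Delta_def psi_def phi_eq_min)

section \<open>Lipschitz estimates for the generators\<close>

lemma psi_lipschitz:
  assumes "s \<in> {0..1}" "x' \<in> {0..1}" "y' \<in> {0..1}"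
  shows "\<bar>psi s x y - psi s' x' y'\<bar> \<le> \<bar>s - s'\<bar> + (\<bar>x - x'\<bar> + \<bar>y - y'\<bar>)"
proof -
  \<comment> \<open>Obtained by inserting \<open>psi s x' y'\<close>: first the arguments change,
    then the parameter.\<close>
  have "psi s x y - psi s' x' y' = (1 - s) * (x - x') + s * (y - y') + (s - s') * (y' - x')"
    by (simp add: psi_def algebra_simps)
  also have "\<bar>\<dots>\<bar> \<le> \<bar>1 - s\<bar> * \<bar>x - x'\<bar> + \<bar>s\<bar> * \<bar>y - y'\<bar> + \<bar>s - s'\<bar> * \<bar>y' - x'\<bar>"
    by (simp only: abs_mult[symmetric])
  also have "\<dots> \<le> 1 * \<bar>x - x'\<bar> + 1 * \<bar>y - y'\<bar> + \<bar>s - s'\<bar> * 1"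
    using assms by (intro add_mono mult_mono) auto
  finally show ?thesis by simp
qed

lemma phi_lipschitz:
  assumes "s \<in> {0..1}" "s' \<in> {0..1}" "x \<in> {0..1}" "y \<in> {0..1}"
  shows "\<bar>phi s x - phi s' y\<bar> \<le> 4 * (\<bar>s - s'\<bar> + \<bar>x - y\<bar>)"
proof -
  have p: "2 - s \<ge> 1" "2 - s' \<ge> 1" using assms by auto
  then have d: "(2 - s) * (2 - s') \<ge> 1" using mult_mono[of 1 "2 - s" 1 "2 - s'"] by simp
  have "\<bar>min 1 u - min 1 v\<bar> \<le> \<bar>u - v\<bar>" for u v :: real
    by (auto simp: min_def)
  then have "\<bar>phi s x - phi s' y\<bar> \<le> \<bar>2 * x / (2 - s) - 2 * y / (2 - s')\<bar>"
    using assms(1,2) by (simp only: phi_eq_min)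
  \<comment> \<open>The product of the denominators is at least 1, and the coefficients 4 - 2 s' and
    2 y are at most 4 in absolute value, whence the constant.\<close>
  also have "2 * x / (2 - s) - 2 * y / (2 - s') =
      ((4 - 2 * s') * (x - y) + 2 * y * (s - s')) / ((2 - s) * (2 - s'))"
    using p by (simp add: field_simps)
  also have "\<bar>\<dots>\<bar> \<le> \<bar>(4 - 2 * s') * (x - y) + 2 * y * (s - s')\<bar>"
    using d divide_left_mono[OF d, of "\<bar>(4 - 2 * s') * (x - y) + 2 * y * (s - s')\<bar>"]
    by (simp add: abs_divide abs_of_nonneg)
  also have "\<dots> \<le> \<bar>4 - 2 * s'\<bar> * \<bar>x - y\<bar> + \<bar>2 * y\<bar> * \<bar>s - s'\<bar>"
    by (metis abs_mult abs_triangle_ineq)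
  also have "\<dots> \<le> 4 * \<bar>x - y\<bar> + 4 * \<bar>s - s'\<bar>"
    using assms by (intro add_mono mult_right_mono) auto
  finally show ?thesis by simp
qed

lemma pi_Delta_lipschitz:
  "\<bar>pi1_Delta x - pi1_Delta y\<bar> \<le> 2 * \<bar>x - y\<bar>" "\<bar>pi2_Delta x - pi2_Delta y\<bar> \<le> 2 * \<bar>x - y\<bar>"
  by (auto simp: pi1_Delta_def pi2_Delta_def abs_if)

text \<open>The factor 4 dominates the individual constants: 1 for \<open>GMu\<close>, 2 for
  \<open>GDelta\<close>, 4 for \<open>GH\<close>.\<close>

lemma gen_fun_lipschitz:
  assumes "gen_dim a = 1 \<Longrightarrow> s \<in> {0..1} \<and> s' \<in> {0..1}"
    and "\<And>i. i < gen_in a \<Longrightarrow> xs i \<in> {0..1} \<and> ys i \<in> {0..1}"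
  shows "\<bar>gen_fun a s xs j - gen_fun a s' ys j\<bar>
           \<le> 4 * ((if gen_dim a = 1 then \<bar>s - s'\<bar> else 0) + (\<Sum>i<gen_in a. \<bar>xs i - ys i\<bar>))"
proof (cases a)
  case GMu
  have "(\<Sum>i<gen_in a. \<bar>xs i - ys i\<bar>) = \<bar>xs 0 - ys 0\<bar> + \<bar>xs 1 - ys 1\<bar>"
    by (simp add: GMu numeral_2_eq_2)
  moreover have "s \<in> {0..1}" "ys 0 \<in> {0..1}" "ys 1 \<in> {0..1}"
    using assms GMu by (auto simp del: atLeastAtMost_iff)
  ultimately have "\<bar>gen_fun a s xs j - gen_fun a s' ys j\<bar>
      \<le> 1 * ((if gen_dim a = 1 then \<bar>s - s'\<bar> else 0) + (\<Sum>i<gen_in a. \<bar>xs i - ys i\<bar>))"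
    using psi_lipschitz[of s "ys 0" "ys 1" "xs 0" "xs 1" s'] GMu by simp
  also have "\<dots> \<le> 4 * ((if gen_dim a = 1 then \<bar>s - s'\<bar> else 0) + (\<Sum>i<gen_in a. \<bar>xs i - ys i\<bar>))"
    by (intro mult_right_mono add_nonneg_nonneg sum_nonneg) auto
  finally show ?thesis .
next
  case GH
  then have "s \<in> {0..1}" "s' \<in> {0..1}" "xs 0 \<in> {0..1}" "ys 0 \<in> {0..1}"
    using assms by (auto simp del: atLeastAtMost_iff)
  then show ?thesis
    using phi_lipschitz[of s s' "xs 0" "ys 0"] GH by (simp del: atLeastAtMost_iff)
next
  case GDelta
  then show ?thesis
    using pi_Delta_lipschitz[of "xs 0" "ys 0"] mult_right_mono[of 2 4 "\<bar>xs 0 - ys 0\<bar>"] by auto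
qed auto

text \<open>The scalar analogue of a valuation.  As an inductive predicate it is deterministic for arbitrary
  wirings, and acyclicity only matters for its totality.\<close>

inductive carries :: "diagram \<Rightarrow> (nat \<Rightarrow> real) \<Rightarrow> source \<Rightarrow> real \<Rightarrow> bool" for D a where
  ext: "i < sh_in (fst D) \<Longrightarrow> carries D a (ExtIn i) (a i)"
| vert: "u \<in> sh_verts (fst D) \<Longrightarrow> j < gen_out (sh_gen (fst D) u) \<Longrightarrow>
    (\<And>i. i < gen_in (sh_gen (fst D) u) \<Longrightarrow> carries D a (sh_wire (fst D) (VertIn u i)) (xs i)) \<Longrightarrow>
    carries D a (VertOut u j) (gen_fun (sh_gen (fst D) u) (snd D u) xs j)"

inductive_cases carries_ExtInE: "carries D a (ExtIn i) x"
inductive_cases carries_VertOutE: "carries D a (VertOut u j) x"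

text \<open>Rule \<open>vert\<close> leaves \<open>xs\<close> arbitrary beyond the input arity;
  values are unique all the same because \<open>gen_fun\<close> reads only the genuine
  inputs.\<close>

lemma carries_unique: "carries D a s x \<Longrightarrow> carries D a s y \<Longrightarrow> x = y"
proof (induction arbitrary: y rule: carries.induct)
  case (ext i) then show ?case by (auto elim: carries_ExtInE)
next
  case (vert u j xs)
  from vert.prems show ?case
    by (rule carries_VertOutE) (use vert in \<open>auto intro!: gen_fun_cong\<close>)
qed

definition unit_params :: "diagram \<Rightarrow> bool" where
  "unit_params D \<longleftrightarrow> (\<forall>u\<in>cell_verts (fst D). snd D u \<in> {0..1})"

lemma unit_paramsD:
  "unit_params D \<Longrightarrow> u \<in> sh_verts (fst D) \<Longrightarrow> gen_dim (sh_gen (fst D) u) = 1 \<Longrightarrow> snd D u \<in> {0..1}"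
  by (auto simp: unit_params_def cell_verts_def)

lemma carries_unit:
  assumes "carries D a s x" "unit_params D" "\<And>i. i < sh_in (fst D) \<Longrightarrow> a i \<in> {0..1}"
  shows "x \<in> {0..1}"
  using assms(1)
proof (induction rule: carries.induct)
  case (vert u j xs)
  then show ?case using assms(2) by (intro gen_fun_unit) (auto dest!: unit_paramsD)
qed (use assms in auto)

text \<open>Induction on the first derivation while inverting the second compares the two input by
  input. It yields monotone profiles, and later monotone coordinates on every vertex input.\<close>

lemma carries_mono:
  assumes "carries D a s x" "carries D b s y" "unit_params D" "\<And>i. i < sh_in (fst D) \<Longrightarrow> a i \<le> b i"
  shows "x \<le> y"
  using assms(1,2)
proof (induction arbitrary: y rule: carries.induct)
  case (ext i) then show ?case using assms(4) by (auto elim: carries_ExtInE)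
next
  case (vert u j xs)
  from vert.prems show ?case
  proof (rule carries_VertOutE, goal_cases)
    case (1 ys)
    then show ?case using vert assms(3) by (auto intro!: gen_fun_mono dest!: unit_paramsD)
  qed
qed

lemma carries_zero:
  assumes "carries D (\<lambda>_. 0) s x" "unit_params D"
  shows "x = 0"
  using assms by (induction rule: carries.induct) (auto intro!: gen_fun_zero dest!: unit_paramsD)

lemma carries_one:
  assumes "carries D (\<lambda>_. 1) s x" "unit_params D"
  shows "x = 1"
  using assms by (induction rule: carries.induct) (auto intro!: gen_fun_one dest!: unit_paramsD)

lemma carries_cong:
  assumes "carries D a s x" "\<And>i. i < sh_in (fst D) \<Longrightarrow> a i = b i"
  shows "carries D b s x"
  using assms(1)
proof (induction rule: carries.induct)
  case (ext i) then show ?case using carries.ext[of i D b] assms(2) by simp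
qed (auto intro: carries.vert)

section \<open>Uniform dependence on inputs and parameters\<close>

text \<open>The constant belongs to the shape: parameters, inputs and derivations are quantified
  inside, so one \<open>L\<close> serves the whole parameter cube.\<close>

definition edge_lipschitz :: "shape \<Rightarrow> source \<Rightarrow> real \<Rightarrow> bool" where
  "edge_lipschitz S s L \<longleftrightarrow> L \<ge> 0 \<and>
     (\<forall>p p' a a' x x'. carries (S, p) a s x \<longrightarrow> carries (S, p') a' s x' \<longrightarrow>
       unit_params (S, p) \<longrightarrow> unit_params (S, p') \<longrightarrow>
       (\<forall>i<sh_in S. a i \<in> {0..1} \<and> a' i \<in> {0..1}) \<longrightarrow>
       \<bar>x - x'\<bar> \<le> L * ((\<Sum>i<sh_in S. \<bar>a i - a' i\<bar>) + (\<Sum>u\<in>cell_verts S. \<bar>p u - p' u\<bar>)))"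

lemma edge_lipschitzD:
  assumes "edge_lipschitz S s L" "carries (S, p) a s x" "carries (S, p') a' s x'"
    "unit_params (S, p)" "unit_params (S, p')" "\<And>i. i < sh_in S \<Longrightarrow> a i \<in> {0..1} \<and> a' i \<in> {0..1}"
  shows "\<bar>x - x'\<bar> \<le> L * ((\<Sum>i<sh_in S. \<bar>a i - a' i\<bar>) + (\<Sum>u\<in>cell_verts S. \<bar>p u - p' u\<bar>))"
  using assms unfolding edge_lipschitz_def by blast

text \<open>One derivation, for some parameters and inputs, exposes the finite tree of vertices
  feeding the edge. Every other derivation for this edge has the same tree, so induction on it gives
  the estimate for all parameters.\<close>

lemma carries_imp_edge_lipschitz:
  assumes "carries (S, q) c s z" "finite (sh_verts S)"
  shows "\<exists>L. edge_lipschitz S s L"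
  using assms(1)
proof (induction rule: carries.induct)
  case (ext i)
  have "edge_lipschitz S (ExtIn i) 1"
    unfolding edge_lipschitz_def
  proof (intro conjI allI impI)
    fix p p' a a' x x'
    assume "carries (S, p) a (ExtIn i) x" "carries (S, p') a' (ExtIn i) x'"
    then have "x = a i" "x' = a' i" by (auto elim: carries_ExtInE)
    moreover have "\<bar>a i - a' i\<bar> \<le> (\<Sum>i<sh_in S. \<bar>a i - a' i\<bar>)"
      using ext by (intro member_le_sum) auto
    ultimately show "\<bar>x - x'\<bar> \<le> 1 * ((\<Sum>i<sh_in S. \<bar>a i - a' i\<bar>) + (\<Sum>u\<in>cell_verts S. \<bar>p u - p' u\<bar>))"
      by (simp add: add_increasing2 sum_nonneg)
  qed auto
  then show ?case ..
next
  case (vert u j xs)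
  let ?g = "sh_gen S u"
  from vert(4) have "\<forall>i\<in>{..<gen_in ?g}. \<exists>L. edge_lipschitz S (sh_wire S (VertIn u i)) L" by simp
  then obtain L where L: "\<And>i. i < gen_in ?g \<Longrightarrow> edge_lipschitz S (sh_wire S (VertIn u i)) (L i)"
    by (metis bchoice lessThan_iff)
  \<comment> \<open>The factor 4 comes from \<open>gen_fun_lipschitz\<close>, the summand 1 from the
    parameter at \<open>u\<close>, and \<open>L i\<close> from the input \<open>i\<close>.\<close>
  define M where "M = 4 * (1 + (\<Sum>i<gen_in ?g. L i))"
  have "edge_lipschitz S (VertOut u j) M"
    unfolding edge_lipschitz_def
  proof (intro conjI allI impI)
    show "M \<ge> 0"
      unfolding M_def
      by (intro mult_nonneg_nonneg add_nonneg_nonneg sum_nonneg) (use L in \<open>auto simp: edge_lipschitz_def\<close>)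
    fix p p' a a' x x'
    assume c: "carries (S, p) a (VertOut u j) x" "carries (S, p') a' (VertOut u j) x'"
      and up: "unit_params (S, p)" "unit_params (S, p')"
      and a: "\<forall>i<sh_in S. a i \<in> {0..1} \<and> a' i \<in> {0..1}"
    define \<delta> where "\<delta> = (\<Sum>i<sh_in S. \<bar>a i - a' i\<bar>) + (\<Sum>u\<in>cell_verts S. \<bar>p u - p' u\<bar>)"
    obtain ys where x: "x = gen_fun ?g (p u) ys j"
      and ys: "\<And>i. i < gen_in ?g \<Longrightarrow> carries (S, p) a (sh_wire S (VertIn u i)) (ys i)"
      using c(1) by (auto elim: carries_VertOutE)
    obtain ys' where x': "x' = gen_fun ?g (p' u) ys' j"
      and ys': "\<And>i. i < gen_in ?g \<Longrightarrow> carries (S, p') a' (sh_wire S (VertIn u i)) (ys' i)"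
      using c(2) by (auto elim: carries_VertOutE)
    have u: "u \<in> sh_verts S" using vert by simp
    have "\<bar>x - x'\<bar> \<le> 4 * ((if gen_dim ?g = 1 then \<bar>p u - p' u\<bar> else 0) + (\<Sum>i<gen_in ?g. \<bar>ys i - ys' i\<bar>))"
      unfolding x x'
    proof (rule gen_fun_lipschitz)
      show "gen_dim ?g = 1 \<Longrightarrow> p u \<in> {0..1} \<and> p' u \<in> {0..1}"
        using unit_paramsD[OF up(1)] unit_paramsD[OF up(2)] u by auto
      show "i < gen_in ?g \<Longrightarrow> ys i \<in> {0..1} \<and> ys' i \<in> {0..1}" for i
        using carries_unit[OF ys up(1)] carries_unit[OF ys' up(2)] a by auto
    qed
    also have "\<dots> \<le> 4 * (\<delta> + (\<Sum>i<gen_in ?g. L i * \<delta>))"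
    proof (intro mult_left_mono add_mono sum_mono)
      have "(if gen_dim ?g = 1 then \<bar>p u - p' u\<bar> else 0) \<le> (\<Sum>u\<in>cell_verts S. \<bar>p u - p' u\<bar>)"
        using u assms(2) by (auto simp: cell_verts_def intro!: member_le_sum sum_nonneg)
      moreover have "0 \<le> (\<Sum>i<sh_in S. \<bar>a i - a' i\<bar>)" by (intro sum_nonneg) auto
      ultimately show "(if gen_dim ?g = 1 then \<bar>p u - p' u\<bar> else 0) \<le> \<delta>"
        unfolding \<delta>_def by linarith
      show "\<bar>ys i - ys' i\<bar> \<le> L i * \<delta>" if "i \<in> {..<gen_in ?g}" for i
        unfolding \<delta>_def using that a by (intro edge_lipschitzD[OF L ys ys' up]) auto
    qed simp
    also have "\<dots> = M * \<delta>"
      by (simp add: M_def distrib_right flip: sum_distrib_right)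
    finally show "\<bar>x - x'\<bar> \<le> M * ((\<Sum>i<sh_in S. \<bar>a i - a' i\<bar>) + (\<Sum>u\<in>cell_verts S. \<bar>p u - p' u\<bar>))"
      unfolding \<delta>_def .
  qed
  then show ?case ..
qed

section \<open>Values of edges and evaluable diagrams\<close>

definition edge_val :: "diagram \<Rightarrow> (nat \<Rightarrow> real) \<Rightarrow> source \<Rightarrow> real" where
  "edge_val D a s = (THE x. carries D a s x)"

abbreviation out_val :: "diagram \<Rightarrow> (nat \<Rightarrow> real) \<Rightarrow> nat \<Rightarrow> real" where
  "out_val D a j \<equiv> edge_val D a (sh_wire (fst D) (ExtOut j))"

lemma edge_val_eqI: "carries D a s x \<Longrightarrow> edge_val D a s = x"
  unfolding edge_val_def by (blast intro: carries_unique)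

text \<open>Stands in for membership in \<open>diagrams\<close> on composites: valid parameters and
  a value on every edge suffice for evaluation, and both pass to compositions by transporting
  derivations.\<close>

definition evaluable :: "diagram \<Rightarrow> bool" where
  "evaluable D \<longleftrightarrow> unit_params D \<and>
     (\<forall>a. \<forall>t\<in>targets (fst D). \<exists>x. carries D a (sh_wire (fst D) t) x)"

lemma carries_edge_val:
  "evaluable D \<Longrightarrow> t \<in> targets (fst D) \<Longrightarrow>
     carries D a (sh_wire (fst D) t) (edge_val D a (sh_wire (fst D) t))"
  unfolding evaluable_def by (metis edge_val_eqI)

lemma targets_iff [simp]:
  "ExtOut j \<in> targets S \<longleftrightarrow> j < sh_out S"
  "VertIn v i \<in> targets S \<longleftrightarrow> v \<in> sh_verts S \<and> i < gen_in (sh_gen S v)"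
  by (auto simp: targets_def)

lemma sources_iff [simp]:
  "ExtIn i \<in> sources S \<longleftrightarrow> i < sh_in S"
  "VertOut v j \<in> sources S \<longleftrightarrow> v \<in> sh_verts S \<and> j < gen_out (sh_gen S v)"
  by (auto simp: sources_def)

lemma carries_out_val:
  "evaluable D \<Longrightarrow> j < sh_out (fst D) \<Longrightarrow> carries D a (sh_wire (fst D) (ExtOut j)) (out_val D a j)"
  by (rule carries_edge_val) auto

lemma out_val_unit:
  assumes "evaluable D" "j < sh_out (fst D)" "\<And>i. i < sh_in (fst D) \<Longrightarrow> a i \<in> {0..1}"
  shows "out_val D a j \<in> {0..1}"
  using carries_unit[OF carries_out_val[OF assms(1,2)]] assms by (auto simp: evaluable_def)

lemma out_val_cong:
  assumes "evaluable D" "j < sh_out (fst D)" "\<And>i. i < sh_in (fst D) \<Longrightarrow> a i = b i"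
  shows "out_val D a j = out_val D b j"
  using edge_val_eqI[OF carries_cong[OF carries_out_val[OF assms(1,2)] assms(3)]] by simp

lemma carries_vertI:
  assumes "u \<in> sh_verts (fst D)" "sh_gen (fst D) u = g" "j < gen_out g"
    and "\<And>i. i < gen_in g \<Longrightarrow> carries D a (sh_wire (fst D) (VertIn u i)) (xs i)"
    and "gen_dim g = 1 \<Longrightarrow> snd D u = s"
  shows "carries D a (VertOut u j) (gen_fun g s xs j)"
proof -
  have "gen_fun g s xs j = gen_fun g (snd D u) xs j"
    using assms(5) by (intro gen_fun_cong) auto
  then show ?thesis using carries.vert[of u D j a xs] assms by auto
qed

text \<open>Finiteness and acyclicity make \<open>edges S\<close> well-founded, so values propagate
  by induction on vertices; the bijection \<open>sh_wire\<close> ensures that every vertex input is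
  fed by a genuine source.\<close>

lemma evaluable_diagram:
  assumes "D \<in> diagrams n m"
  shows "evaluable D"
proof -
  obtain S p where D: "D = (S, p)" by (cases D)
  have S: "finite (sh_verts S)" "bij_betw (sh_wire S) (targets S) (sources S)" "acyclic (edges S)"
    and p: "p \<in> params S"
    using assms by (auto simp: D diagrams_def shapes_def)
  have wire: "sh_wire S t \<in> sources S" if "t \<in> targets S" for t
    using S(2) that by (auto simp: bij_betw_def)
  have "finite (edges S)"
    using S(1) by (rule_tac finite_subset[of _ "sh_verts S \<times> sh_verts S"]) (auto simp: edges_def)
  then have wf: "wf (edges S)" using S(3) by (rule finite_acyclic_wf)
  have vert: "u \<in> sh_verts S \<longrightarrow> (\<forall>j<gen_out (sh_gen S u). \<exists>x. carries D a (VertOut u j) x)" for a u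
    using wf
  proof (induction u rule: wf_induct_rule)
    case (less u)
    show ?case
    proof (intro impI allI)
      fix j assume u: "u \<in> sh_verts S" and j: "j < gen_out (sh_gen S u)"
      have "\<exists>x. carries D a (sh_wire S (VertIn u i)) x" if i: "i < gen_in (sh_gen S u)" for i
      proof (cases "sh_wire S (VertIn u i)")
        case (ExtIn k)
        then have "k < sh_in (fst D)" using wire[of "VertIn u i"] u i by (simp add: D)
        then show ?thesis using carries.ext ExtIn by metis
      next
        case (VertOut v k)
        then have "v \<in> sh_verts S" "k < gen_out (sh_gen S v)" using wire[of "VertIn u i"] u i by auto
        moreover from this have "(v, u) \<in> edges S" using u i VertOut by (auto simp: edges_def)
        ultimately show ?thesis using less VertOut by simp
      qed
      then obtain xs where "\<And>i. i < gen_in (sh_gen S u) \<Longrightarrow> carries D a (sh_wire S (VertIn u i)) (xs i)"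
        by metis
      then show "\<exists>x. carries D a (VertOut u j) x"
        using carries_vertI[of u D "sh_gen S u" j a xs "p u"] u j by (auto simp: D)
    qed
  qed
  have "\<exists>x. carries D a (sh_wire S t) x" if "t \<in> targets S" for a t
  proof (cases "sh_wire S t")
    case (ExtIn k)
    then have "k < sh_in (fst D)" using wire[of t] that by (simp add: D)
    then show ?thesis using carries.ext ExtIn by metis
  next
    case (VertOut v k)
    then show ?thesis using wire[of t] that vert by simp
  qed
  moreover have "unit_params D"
    using p by (auto simp: D unit_params_def params_def PiE_iff)
  ultimately show ?thesis by (simp add: evaluable_def D)
qed

lemma carries_iso:
  assumes "carries D a s x" "diagram_iso f D E"
  shows "carries E a (map_source id f s) x"
  using assms(1)
proof (induction rule: carries.induct)
  case (ext i)
  then show ?case using carries.ext[of i E a] assms(2) by (simp add: diagram_iso_def)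
next
  case (vert u j xs)
  have iso: "f u \<in> sh_verts (fst E)" "sh_gen (fst E) (f u) = sh_gen (fst D) u"
    "gen_dim (sh_gen (fst D) u) = 1 \<Longrightarrow> snd E (f u) = snd D u"
    using assms(2) vert(1) by (auto simp: diagram_iso_def bij_betw_def cell_verts_def)
  have "sh_wire (fst E) (VertIn (f u) i) = map_source id f (sh_wire (fst D) (VertIn u i))"
    if "i < gen_in (sh_gen (fst D) u)" for i
    using assms(2) vert(1) that unfolding diagram_iso_def
    by (metis map_target.simps(2) targets_iff(2))
  then show ?case
    unfolding map_source.simps using vert iso by (intro carries_vertI) (simp_all add: id_def)
qed

lemma out_val_iso:
  assumes "diagram_iso f D E" "evaluable D" "j < sh_out (fst D)"
  shows "out_val E a j = out_val D a j"
proof -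
  have "ExtOut j \<in> targets (fst D)" using assms by simp
  then have "sh_wire (fst E) (ExtOut j) = map_source id f (sh_wire (fst D) (ExtOut j))"
    using assms(1) unfolding diagram_iso_def by (metis map_target.simps(1))
  then show ?thesis
    using carries_iso[OF carries_out_val[OF assms(2,3)] assms(1)] by (simp add: edge_val_eqI)
qed

subsection \<open>Compositions\<close>

lemma sh_comp_simps [simp]:
  "sh_in (fst (d_comp E D)) = sh_in (fst D)" "sh_out (fst (d_comp E D)) = sh_out (fst E)"
  "sh_in (fst (d_times D E)) = sh_in (fst D) + sh_in (fst E)"
  "sh_out (fst (d_times D E)) = sh_out (fst D) + sh_out (fst E)"
  by (simp_all add: d_comp_def d_times_def shape_comp_def shape_times_def)

lemma join_simps:
  "2 * v \<in> join_verts F G \<longleftrightarrow> v \<in> sh_verts F"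
  "Suc (2 * v) \<in> join_verts F G \<longleftrightarrow> v \<in> sh_verts G"
  "join_gen F G (2 * v) = sh_gen F v"
  "join_gen F G (Suc (2 * v)) = sh_gen G v"
  by (auto simp: join_verts_def join_gen_def image_iff; presburger)+

lemma join_params_simps:
  "v \<in> cell_verts (fst D) \<Longrightarrow> join_params D E (2 * v) = snd D v"
  "v \<in> cell_verts (fst E) \<Longrightarrow> join_params D E (Suc (2 * v)) = snd E v"
  by (auto simp: join_params_def image_iff; presburger)+

lemma unit_params_join:
  assumes "unit_params D" "unit_params E"
    and "sh_verts S = join_verts (fst D) (fst E)" "sh_gen S = join_gen (fst D) (fst E)"
  shows "unit_params (S, join_params D E)"
proof -
  have "join_params D E w \<in> {0..1}" if w: "w \<in> cell_verts S" for w
  proof (cases "even w")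
    case True
    then obtain v where v: "w = 2 * v" by blast
    then have "v \<in> cell_verts (fst D)" using w assms by (simp add: cell_verts_def join_simps)
    then show ?thesis using assms(1) by (simp add: v join_params_simps unit_params_def)
  next
    case False
    then obtain v where v: "w = Suc (2 * v)" by (metis oddE Suc_eq_plus1)
    then have "v \<in> cell_verts (fst E)" using w assms by (simp add: cell_verts_def join_simps)
    then show ?thesis using assms(2) by (simp add: v join_params_simps unit_params_def)
  qed
  then show ?thesis by (simp add: unit_params_def)
qed

lemma target_join_cases:
  assumes "t \<in> targets S" "sh_verts S = join_verts F G" "sh_gen S = join_gen F G"
  obtains (out) j where "t = ExtOut j" "j < sh_out S"
  | (left) v i where "t = VertIn (2 * v) i" "VertIn v i \<in> targets F"
  | (right) v i where "t = VertIn (Suc (2 * v)) i" "VertIn v i \<in> targets G"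
proof (cases t)
  case (ExtOut j)
  then show ?thesis using assms out by simp
next
  case (VertIn w i)
  then have w: "w \<in> join_verts F G" "i < gen_in (join_gen F G w)" using assms by auto
  show ?thesis
  proof (cases "even w")
    case True
    then obtain v where v: "w = 2 * v" by blast
    then show ?thesis using VertIn w left by (simp add: join_simps)
  next
    case False
    then obtain v where v: "w = Suc (2 * v)" by (metis oddE Suc_eq_plus1)
    then show ?thesis using VertIn w right by (simp add: join_simps)
  qed
qed

lemma carries_comp_first:
  assumes "carries D a s x"
  shows "carries (d_comp E D) a (map_source id (\<lambda>v. 2 * v) s) x"
  using assms
proof (induction rule: carries.induct)
  case (ext i)
  then show ?case using carries.ext[of i "d_comp E D" a] by simp
next
  case (vert u j xs)
  show ?case unfolding map_source.simps
  proof (rule carries_vertI)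
    show "carries (d_comp E D) a (sh_wire (fst (d_comp E D)) (VertIn (2 * u) i)) (xs i)"
      if "i < gen_in (sh_gen (fst D) u)" for i
      using vert(4)[OF that] by (simp add: d_comp_def shape_comp_def id_def)
  qed (use vert in \<open>auto simp: d_comp_def shape_comp_def join_simps join_params_simps cell_verts_def\<close>)
qed

text \<open>Splicing replaces the external input \<open>i\<close> of \<open>E\<close> by the edge of
  \<open>D\<close> feeding its output \<open>i\<close>, which carries \<open>b i\<close>;
  derivations in \<open>E\<close> thus continue derivations in \<open>D\<close>.\<close>

lemma carries_comp_second:
  assumes "carries E b s x"
    and b: "\<And>i. i < sh_in (fst E) \<Longrightarrow> carries D a (sh_wire (fst D) (ExtOut i)) (b i)"
  shows "carries (d_comp E D) a (splice (fst D) s) x"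
  using assms(1)
proof (induction rule: carries.induct)
  case (ext i)
  then show ?case using carries_comp_first[OF b[OF ext]] by (simp add: splice_def)
next
  case (vert u j xs)
  have "splice (fst D) (VertOut u j) = VertOut (Suc (2 * u)) j" by (simp add: splice_def)
  then show ?case
  proof (simp only:, rule_tac carries_vertI)
    show "carries (d_comp E D) a (sh_wire (fst (d_comp E D)) (VertIn (Suc (2 * u)) i)) (xs i)"
      if "i < gen_in (sh_gen (fst E) u)" for i
      using vert(4)[OF that] by (simp add: d_comp_def shape_comp_def id_def)
  qed (use vert in \<open>auto simp: d_comp_def shape_comp_def join_simps join_params_simps cell_verts_def\<close>)
qed

lemma evaluable_comp:
  assumes D: "evaluable D" and E: "evaluable E" and "sh_in (fst E) = sh_out (fst D)"
  shows "evaluable (d_comp E D)"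
  unfolding evaluable_def
proof (intro conjI allI ballI)
  show "unit_params (d_comp E D)"
    using D E unit_params_join[of D E] by (auto simp: evaluable_def d_comp_def shape_comp_def)
  fix a t assume t: "t \<in> targets (fst (d_comp E D))"
  have b: "carries D a (sh_wire (fst D) (ExtOut i)) (out_val D a i)" if "i < sh_in (fst E)" for i
    using carries_out_val[OF D] that assms(3) by simp
  have join: "sh_verts (fst (d_comp E D)) = join_verts (fst D) (fst E)"
    "sh_gen (fst (d_comp E D)) = join_gen (fst D) (fst E)" by (simp_all add: d_comp_def shape_comp_def)
  from t join show "\<exists>x. carries (d_comp E D) a (sh_wire (fst (d_comp E D)) t) x"
  proof (cases rule: target_join_cases)
    case (out j)
    then show ?thesis using carries_comp_second[OF carries_out_val[OF E] b]
      by (auto simp: d_comp_def shape_comp_def)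
  next
    case (left v i)
    then show ?thesis using carries_comp_first[OF carries_edge_val[OF D left(2)], of E a]
      by (auto simp: d_comp_def shape_comp_def)
  next
    case (right v i)
    then show ?thesis using carries_comp_second[OF carries_edge_val[OF E right(2)] b]
      by (auto simp: d_comp_def shape_comp_def)
  qed
qed

lemma out_val_comp:
  assumes D: "evaluable D" and E: "evaluable E" and "sh_in (fst E) = sh_out (fst D)"
    and j: "j < sh_out (fst E)"
  shows "out_val (d_comp E D) a j = out_val E (out_val D a) j"
proof -
  have "carries D a (sh_wire (fst D) (ExtOut i)) (out_val D a i)" if "i < sh_in (fst E)" for i
    using carries_out_val[OF D] that assms(3) by simp
  from carries_comp_second[OF carries_out_val[OF E j] this]
  show ?thesis by (intro edge_val_eqI) (simp add: d_comp_def shape_comp_def)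
qed

lemma carries_times_left:
  assumes "carries D a s x"
  shows "carries (d_times D E) a (map_source id (\<lambda>v. 2 * v) s) x"
  using assms
proof (induction rule: carries.induct)
  case (ext i)
  then show ?case using carries.ext[of i "d_times D E" a] by simp
next
  case (vert u j xs)
  show ?case unfolding map_source.simps
  proof (rule carries_vertI)
    show "carries (d_times D E) a (sh_wire (fst (d_times D E)) (VertIn (2 * u) i)) (xs i)"
      if "i < gen_in (sh_gen (fst D) u)" for i
      using vert(4)[OF that] by (simp add: d_times_def shape_times_def Let_def id_def)
  qed (use vert in \<open>auto simp: d_times_def shape_times_def join_simps join_params_simps cell_verts_def\<close>)
qed

lemma carries_times_right:
  assumes "carries E (\<lambda>i. a (sh_in (fst D) + i)) s x"
  shows "carries (d_times D E) a (map_source (\<lambda>i. sh_in (fst D) + i) (\<lambda>v. 2 * v + 1) s) x"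
  using assms
proof (induction rule: carries.induct)
  case (ext i)
  then show ?case using carries.ext[of "sh_in (fst D) + i" "d_times D E" a] by simp
next
  case (vert u j xs)
  have "map_source (\<lambda>i. sh_in (fst D) + i) (\<lambda>v. 2 * v + 1) (VertOut u j) = VertOut (Suc (2 * u)) j" by simp
  then show ?case
  proof (simp only:, rule_tac carries_vertI)
    show "carries (d_times D E) a (sh_wire (fst (d_times D E)) (VertIn (Suc (2 * u)) i)) (xs i)"
      if "i < gen_in (sh_gen (fst E) u)" for i
      using vert(4)[OF that] by (simp add: d_times_def shape_times_def Let_def id_def)
  qed (use vert in \<open>auto simp: d_times_def shape_times_def join_simps join_params_simps cell_verts_def\<close>)
qed

lemma evaluable_times:
  assumes D: "evaluable D" and E: "evaluable E"
  shows "evaluable (d_times D E)"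
  unfolding evaluable_def
proof (intro conjI allI ballI)
  show "unit_params (d_times D E)"
    using D E unit_params_join[of D E] by (auto simp: evaluable_def d_times_def shape_times_def)
  fix a t assume t: "t \<in> targets (fst (d_times D E))"
  have join: "sh_verts (fst (d_times D E)) = join_verts (fst D) (fst E)"
    "sh_gen (fst (d_times D E)) = join_gen (fst D) (fst E)" by (simp_all add: d_times_def shape_times_def)
  from t join show "\<exists>x. carries (d_times D E) a (sh_wire (fst (d_times D E)) t) x"
  proof (cases rule: target_join_cases)
    case (out j)
    show ?thesis
    proof (cases "j < sh_out (fst D)")
      case True
      then show ?thesis using carries_times_left[OF carries_out_val[OF D True], of E a] out
        by (auto simp: d_times_def shape_times_def Let_def)
    next
      case False
      then have "j - sh_out (fst D) < sh_out (fst E)" using out by simp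
      then show ?thesis using carries_times_right[of E a D, OF carries_out_val[OF E]] out False
        by (auto simp: d_times_def shape_times_def Let_def)
    qed
  next
    case (left v i)
    then show ?thesis using carries_times_left[OF carries_edge_val[OF D left(2)], of E a]
      by (auto simp: d_times_def shape_times_def Let_def)
  next
    case (right v i)
    then show ?thesis using carries_times_right[of E a D, OF carries_edge_val[OF E right(2)]]
      by (auto simp: d_times_def shape_times_def Let_def)
  qed
qed

lemma out_val_times:
  assumes D: "evaluable D" and E: "evaluable E" and j: "j < sh_out (fst D) + sh_out (fst E)"
  shows "out_val (d_times D E) a j =
     (if j < sh_out (fst D) then out_val D a j
      else out_val E (\<lambda>i. a (sh_in (fst D) + i)) (j - sh_out (fst D)))"
proof (cases "j < sh_out (fst D)")
  case True
  from carries_times_left[OF carries_out_val[OF D True], of E a] True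
  show ?thesis by (auto intro!: edge_val_eqI simp: d_times_def shape_times_def Let_def)
next
  case False
  then have "j - sh_out (fst D) < sh_out (fst E)" using j by simp
  from carries_times_right[of E a D, OF carries_out_val[OF E this]] False
  show ?thesis by (auto intro!: edge_val_eqI simp: d_times_def shape_times_def Let_def)
qed

subsection \<open>Generators\<close>

lemma sh_gen_simps [simp]:
  "sh_in (fst (d_gen g s)) = gen_in g" "sh_out (fst (d_gen g s)) = gen_out g"
  "sh_in (fst (d_perm m \<sigma>)) = m" "sh_out (fst (d_perm m \<sigma>)) = m"
  by (simp_all add: d_gen_def d_perm_def)

lemma diagram_perm:
  assumes "\<sigma> permutes {..<m}"
  shows "d_perm m \<sigma> \<in> diagrams m m"
proof -
  have inv: "inv \<sigma> permutes {..<m}" using assms by (rule permutes_inv)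
  have t: "targets (fst (d_perm m \<sigma>)) = ExtOut ` {..<m}" "sources (fst (d_perm m \<sigma>)) = ExtIn ` {..<m}"
    by (auto simp: targets_def sources_def d_perm_def)
  have "bij_betw (sh_wire (fst (d_perm m \<sigma>))) (ExtOut ` {..<m}) (ExtIn ` {..<m})"
    unfolding bij_betw_def
  proof
    show "inj_on (sh_wire (fst (d_perm m \<sigma>))) (ExtOut ` {..<m})"
      using permutes_inj[OF inv] by (auto simp: inj_on_def d_perm_def)
    have "sh_wire (fst (d_perm m \<sigma>)) ` ExtOut ` {..<m} = ExtIn ` inv \<sigma> ` {..<m}"
      by (auto simp: d_perm_def image_iff)
    then show "sh_wire (fst (d_perm m \<sigma>)) ` ExtOut ` {..<m} = ExtIn ` {..<m}"
      using permutes_image[OF inv] by simp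
  qed
  moreover have "edges (fst (d_perm m \<sigma>)) = {}" by (auto simp: edges_def d_perm_def)
  ultimately show ?thesis
    unfolding diagrams_def shapes_def t[symmetric]
    by (auto simp: d_perm_def params_def cell_verts_def acyclic_def)
qed

lemma diagram_id: "d_id n \<in> diagrams n n"
  by (rule diagram_perm) (simp add: permutes_id)

lemma out_val_perm:
  assumes "\<sigma> permutes {..<m}" "j < m"
  shows "out_val (d_perm m \<sigma>) a j = a (inv \<sigma> j)"
proof -
  have "inv \<sigma> j < m" using permutes_in_image[OF permutes_inv[OF assms(1)], of j] assms(2) by simp
  then have "carries (d_perm m \<sigma>) a (ExtIn (inv \<sigma> j)) (a (inv \<sigma> j))"
    by (intro carries.ext) simp
  then show ?thesis by (intro edge_val_eqI) (simp add: d_perm_def)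
qed

lemma out_val_id: "j < m \<Longrightarrow> out_val (d_id m) a j = a j"
  by (simp add: out_val_perm permutes_id)

lemma carries_gen:
  assumes "j < gen_out g"
  shows "carries (d_gen g s) a (VertOut 0 j) (gen_fun g s a j)"
proof (rule carries_vertI)
  show "carries (d_gen g s) a (sh_wire (fst (d_gen g s)) (VertIn 0 i)) (a i)" if "i < gen_in g" for i
    using carries.ext[of i "d_gen g s" a] that by (simp add: d_gen_def)
qed (use assms in \<open>auto simp: d_gen_def\<close>)

lemma evaluable_gen:
  assumes "s \<in> {0..1}"
  shows "evaluable (d_gen g s)"
  unfolding evaluable_def
proof (intro conjI allI ballI)
  show "unit_params (d_gen g s)" using assms by (auto simp: unit_params_def cell_verts_def d_gen_def)
  fix a t assume t: "t \<in> targets (fst (d_gen g s))"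
  show "\<exists>x. carries (d_gen g s) a (sh_wire (fst (d_gen g s)) t) x"
  proof (cases t)
    case (ExtOut j)
    then show ?thesis using t carries_gen[of j g s a] by (auto simp: d_gen_def)
  next
    case (VertIn v i)
    then show ?thesis using t carries.ext[of i "d_gen g s" a] by (auto simp: d_gen_def)
  qed
qed

lemma out_val_gen: "j < gen_out g \<Longrightarrow> out_val (d_gen g s) a j = gen_fun g s a j"
  using carries_gen[of j g s a] by (intro edge_val_eqI) (simp add: d_gen_def)

subsection \<open>Invariance under the relations\<close>

text \<open>Inputs are confined to the unit interval because of the relation \<open>h_0\<close>:
  \<open>phi 0\<close> is the identity only up to 1.\<close>

definition same_action :: "diagram \<Rightarrow> diagram \<Rightarrow> bool" where
  "same_action D E \<longleftrightarrow> evaluable D \<and> evaluable E \<and>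
     sh_in (fst D) = sh_in (fst E) \<and> sh_out (fst D) = sh_out (fst E) \<and>
     (\<forall>a j. (\<forall>i<sh_in (fst D). a i \<in> {0..1}) \<longrightarrow> j < sh_out (fst D) \<longrightarrow> out_val D a j = out_val E a j)"

lemma same_action_comp:
  assumes "same_action E E'" "same_action D D'" "sh_in (fst E) = sh_out (fst D)"
  shows "same_action (d_comp E D) (d_comp E' D')"
proof -
  have "out_val (d_comp E D) a j = out_val (d_comp E' D') a j"
    if a: "\<forall>i<sh_in (fst D). a i \<in> {0..1}" and j: "j < sh_out (fst E)" for a j
  proof -
    have "out_val (d_comp E D) a j = out_val E (out_val D a) j"
      using assms j by (intro out_val_comp) (auto simp: same_action_def)
    also have "\<dots> = out_val E (out_val D' a) j"
      using assms j a by (intro out_val_cong) (auto simp: same_action_def)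
    \<comment> \<open>\<open>E\<close> and \<open>E'\<close> are known to agree on unit inputs only,
      so the intermediate values must first be located in the unit interval.\<close>
    also have "\<dots> = out_val E' (out_val D' a) j"
    proof -
      have "\<forall>i<sh_in (fst E). out_val D' a i \<in> {0..1}"
        using assms a by (auto simp: same_action_def intro!: out_val_unit simp del: atLeastAtMost_iff)
      then show ?thesis using assms(1) j by (simp add: same_action_def)
    qed
    also have "\<dots> = out_val (d_comp E' D') a j"
      using assms j by (intro out_val_comp[symmetric]) (auto simp: same_action_def)
    finally show ?thesis .
  qed
  then show ?thesis
    using assms by (auto simp: same_action_def evaluable_comp simp del: atLeastAtMost_iff)
qed

lemma same_action_times:
  assumes "same_action D D'" "same_action E E'"
  shows "same_action (d_times D E) (d_times D' E')"
proof -
  have "out_val (d_times D E) a j = out_val (d_times D' E') a j"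
    if a: "\<forall>i<sh_in (fst D) + sh_in (fst E). a i \<in> {0..1}" and j: "j < sh_out (fst D) + sh_out (fst E)" for a j
  proof -
    have "\<forall>i<sh_in (fst D). a i \<in> {0..1}" "\<forall>i<sh_in (fst E). a (sh_in (fst D) + i) \<in> {0..1}"
      using a by auto
    then show ?thesis
      using assms j by (auto simp: same_action_def out_val_times simp del: atLeastAtMost_iff)
  qed
  then show ?thesis
    using assms by (auto simp: same_action_def evaluable_times simp del: atLeastAtMost_iff)
qed

lemma evaluable_id: "evaluable (d_id n)"
  using diagram_id by (rule evaluable_diagram)

text \<open>The attaching relations hold because \<open>psi 0\<close> and \<open>psi 1\<close> are
  the projections, \<open>phi 0\<close> is the identity on the unit interval and
  \<open>phi 1\<close> is \<open>pi2_Delta\<close>. The relations ending in \<open>GEps\<close> have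
  no outputs, which leaves arities and evaluability.\<close>

lemma st_eq_imp_same_action: "st_eq D E \<Longrightarrow> same_action D E"
proof (induction rule: st_eq.induct)
  case (iso D n m E f)
  have "evaluable D" "evaluable E" using iso by (auto intro: evaluable_diagram)
  moreover have "sh_in (fst D) = sh_in (fst E)" "sh_out (fst D) = sh_out (fst E)"
    using iso(3) by (auto simp: diagram_iso_def)
  ultimately show ?case
    using out_val_iso[OF iso(3)] unfolding same_action_def by metis
next
  case (sym D E) then show ?case by (auto simp: same_action_def)
next
  case (trans C D E) then show ?case by (auto simp: same_action_def)
next
  case (comp E E' D D') then show ?case by (intro same_action_comp)
next
  case (times D D' E E') then show ?case by (intro same_action_times)
next
  \<comment> \<open>The factor \<open>d_id 1\<close> reads output 1 of \<open>d_delta\<close>, whose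
    value is \<open>pi2_Delta\<close>.\<close>
  case h_1
  show ?case unfolding same_action_def
    by (auto simp: evaluable_gen evaluable_id evaluable_comp evaluable_times
      out_val_comp out_val_times out_val_gen out_val_id phi_def pi2_Delta_def)
qed (auto simp: same_action_def evaluable_gen evaluable_id evaluable_comp evaluable_times
    out_val_times out_val_gen out_val_id psi_def phi_def)

subsection \<open>The prop\<close>

text \<open>\<open>st_eq\<close> is only a partial equivalence on raw diagrams. From here on
  \<open>st_eq D D\<close> serves as the well-formedness condition: the rules \<open>comp\<close>
  and \<open>times\<close> give it for composites, and it implies evaluability.\<close>

lemma st_eq_refl:
  assumes "D \<in> diagrams n m"
  shows "st_eq D D"
proof (rule st_eq.iso[OF assms assms])
  have "map_source id id s = s" for s by (cases s) auto
  moreover have "map_target id t = t" for t by (cases t) auto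
  ultimately show "diagram_iso id D D" by (simp add: diagram_iso_def)
qed

lemma st_class_eqI: "st_eq D E \<Longrightarrow> st_class D = st_class E"
  unfolding st_class_def using st_eq.trans[of D E] st_eq.trans[OF st_eq.sym, of D E]
  by (intro Collect_cong iffI)

lemma st_class_refl: "st_eq D D \<Longrightarrow> D \<in> st_class D"
  by (simp add: st_class_def)

text \<open>The operation is a union over all representatives; by the congruence rule all classes in
  that union coincide, and reflexivity makes it nonempty.\<close>

lemma pcomp_st_class:
  assumes "st_eq E E" "st_eq D D" "sh_in (fst E) = sh_out (fst D)"
  shows "pcomp St (st_class E) (st_class D) = st_class (d_comp E D)"
proof -
  have "st_class (d_comp E' D') = st_class (d_comp E D)" if "E' \<in> st_class E" "D' \<in> st_class D" for E' D'
  proof (rule st_class_eqI[symmetric])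
    show "st_eq (d_comp E D) (d_comp E' D')"
      using that assms(3) unfolding st_class_def mem_Collect_eq by (rule st_eq.comp)
  qed
  then have "(\<Union>E'\<in>st_class E. \<Union>D'\<in>st_class D. st_class (d_comp E' D')) = st_class (d_comp E D)"
    using assms(1,2) by (intro UN_constant_eq[of E] UN_constant_eq[of D] ballI st_class_refl)
  then show ?thesis by (simp add: St_def)
qed

lemma ptimes_st_class:
  assumes "st_eq D D" "st_eq E E"
  shows "ptimes St (st_class D) (st_class E) = st_class (d_times D E)"
proof -
  have "st_class (d_times D' E') = st_class (d_times D E)" if "D' \<in> st_class D" "E' \<in> st_class E" for D' E'
  proof (rule st_class_eqI[symmetric])
    show "st_eq (d_times D E) (d_times D' E')"
      using that unfolding st_class_def mem_Collect_eq by (rule st_eq.times)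
  qed
  then have "(\<Union>D'\<in>st_class D. \<Union>E'\<in>st_class E. st_class (d_times D' E')) = st_class (d_times D E)"
    using assms by (intro UN_constant_eq[of D] UN_constant_eq[of E] ballI st_class_refl)
  then show ?thesis by (simp add: St_def)
qed

section \<open>Iterated horizontal composites\<close>

definition tensor :: "diagram list \<Rightarrow> diagram" where
  "tensor Ds = foldr d_times Ds (d_id 0)"

lemma tensor_simps [simp]:
  "tensor [] = d_id 0" "tensor (D # Ds) = d_times D (tensor Ds)"
  by (simp_all add: tensor_def)

lemma st_eq_tensor: "\<forall>D\<in>set Ds. st_eq D D \<Longrightarrow> st_eq (tensor Ds) (tensor Ds)"
  by (induction Ds) (auto intro: st_eq.times st_eq_refl[OF diagram_id])

lemma foldr_ptimes_st_class:
  "\<forall>D\<in>set Ds. st_eq D D \<Longrightarrow> foldr (ptimes St) (map st_class Ds) (pone St 0) = st_class (tensor Ds)"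
proof (induction Ds)
  case Nil
  show ?case by (simp add: St_def)
next
  case (Cons D Ds)
  then show ?case by (simp add: ptimes_st_class st_eq_tensor)
qed

lemma sh_out_tensor: "sh_out (fst (tensor Ds)) = sum_list (map (\<lambda>D. sh_out (fst D)) Ds)"
  by (induction Ds) auto

lemma sh_in_tensor: "\<forall>D\<in>set Ds. sh_in (fst D) = 1 \<Longrightarrow> sh_in (fst (tensor Ds)) = length Ds"
  by (induction Ds) auto

lemma st_eq_evaluable: "st_eq D D \<Longrightarrow> evaluable D"
  using st_eq_imp_same_action by (auto simp: same_action_def)

lemma sum_list_take_add_less:
  fixes ks :: "nat list"
  assumes "i < length ks" "j < ks ! i"
  shows "sum_list (take i ks) + j < sum_list ks"
proof -
  have "sum_list ks = sum_list (take i ks) + sum_list (ks ! i # drop (Suc i) ks)"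
    using assms(1) by (metis Cons_nth_drop_Suc append_take_drop_id sum_list_append)
  then show ?thesis using assms(2) by simp
qed

text \<open>Peeling off the head with \<open>out_val_times\<close> shifts the outputs by its output
  arity and the inputs by one; as every factor has a single input, block \<open>i\<close> reads
  input \<open>i\<close> alone.\<close>

lemma out_val_tensor:
  assumes "\<forall>D\<in>set Ds. st_eq D D \<and> sh_in (fst D) = 1" "i < length Ds" "j < sh_out (fst (Ds ! i))"
  shows "out_val (tensor Ds) b (sum_list (take i (map (\<lambda>D. sh_out (fst D)) Ds)) + j)
           = out_val (Ds ! i) (\<lambda>_. b i) j"
  using assms
proof (induction Ds arbitrary: i b)
  case (Cons D Ds)
  have ev: "evaluable D" "evaluable (tensor Ds)"
    using Cons.prems by (auto intro!: st_eq_evaluable st_eq_tensor)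
  show ?case
  proof (cases i)
    case 0
    then have "out_val (tensor (D # Ds)) b (sum_list (take i (map (\<lambda>D. sh_out (fst D)) (D # Ds))) + j)
        = out_val D b j" using Cons.prems ev by (simp add: out_val_times)
    also have "\<dots> = out_val D (\<lambda>_. b i) j"
      using Cons.prems ev 0 by (intro out_val_cong) auto
    finally show ?thesis using 0 by simp
  next
    case (Suc i')
    let ?s = "sum_list (take i' (map (\<lambda>D. sh_out (fst D)) Ds))"
    have "?s + j < sh_out (fst (tensor Ds))"
      using Cons.prems Suc sum_list_take_add_less[of i' "map (\<lambda>D. sh_out (fst D)) Ds" j]
      by (simp add: sh_out_tensor)
    then have "out_val (tensor (D # Ds)) b (sum_list (take i (map (\<lambda>D. sh_out (fst D)) (D # Ds))) + j)
        = out_val (tensor Ds) (\<lambda>i. b (Suc i)) (?s + j)"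
      using Cons.prems ev Suc by (simp add: out_val_times add.assoc)
    also have "\<dots> = out_val (Ds ! i') (\<lambda>_. b (Suc i')) j"
      using Cons.prems Suc by (intro Cons.IH) auto
    finally show ?thesis using Suc by simp
  qed
qed simp

subsection \<open>Operations on simplices\<close>

text \<open>\<open>profile D i\<close> is the self-map of the interval by which \<open>D\<close> acts on each coordinate of a point,
  as seen at the output \<open>i\<close>.\<close>

definition profile :: "diagram \<Rightarrow> nat \<Rightarrow> real \<Rightarrow> real" where
  "profile D i t = out_val D (\<lambda>_. t) i"

definition interval_map :: "(real \<Rightarrow> real) \<Rightarrow> bool" where
  "interval_map \<theta> \<longleftrightarrow> mono_on {0..1} \<theta> \<and> \<theta> 0 = 0 \<and> \<theta> 1 = 1"

lemma interval_map_unit: "interval_map \<theta> \<Longrightarrow> t \<in> {0..1} \<Longrightarrow> \<theta> t \<in> {0..1}"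
  using mono_onD[of "{0..1}" \<theta> 0 t] mono_onD[of "{0..1}" \<theta> t 1] by (auto simp: interval_map_def)

lemma interval_map_profile:
  assumes "evaluable D" "i < sh_out (fst D)"
  shows "interval_map (profile D i)"
proof -
  note c = carries_out_val[OF assms]
  have u: "unit_params D" using assms(1) by (simp add: evaluable_def)
  show ?thesis
    unfolding interval_map_def profile_def
    using carries_mono[OF c c u] carries_zero[OF c u] carries_one[OF c u] by (auto intro!: mono_onI)
qed

definition apply_pt :: "nat \<Rightarrow> (real \<Rightarrow> real) \<Rightarrow> point \<Rightarrow> point" where
  "apply_pt d \<theta> x = (\<lambda>k\<in>{1..d}. \<theta> (x k))"

lemma simplex_pts_iff:
  "x \<in> simplex_pts d \<longleftrightarrow> x \<in> extensional {1..d} \<and> (\<forall>i\<in>{1..d}. x i \<in> {0..1}) \<and>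
     (\<forall>i\<in>{1..d}. \<forall>j\<in>{1..d}. i \<le> j \<longrightarrow> x i \<le> x j)"
  by (auto simp: simplex_pts_def PiE_iff)

lemma apply_pt_in_simplex:
  assumes "interval_map \<theta>" "x \<in> simplex_pts d"
  shows "apply_pt d \<theta> x \<in> simplex_pts d"
proof -
  have "\<theta> (x i) \<in> {0..1}" if "i \<in> {1..d}" for i
    using assms that interval_map_unit[of \<theta> "x i"] by (simp add: simplex_pts_iff del: atLeastAtMost_iff)
  moreover have "\<theta> (x i) \<le> \<theta> (x j)" if "i \<in> {1..d}" "j \<in> {1..d}" "i \<le> j" for i j
    using assms that by (intro mono_onD[of "{0..1}" \<theta>])
      (auto simp: simplex_pts_iff interval_map_def simp del: atLeastAtMost_iff)
  ultimately show ?thesis by (simp add: simplex_pts_iff apply_pt_def del: atLeastAtMost_iff)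
qed

lemma coface_in_simplex:
  assumes "x \<in> simplex_pts d" "i \<le> d + 1"
  shows "coface d i x \<in> simplex_pts (d + 1)"
proof -
  have x: "0 \<le> x k" "x k \<le> 1" if "1 \<le> k" "k \<le> d" for k
    using assms(1) that by (auto simp: simplex_pts_iff)
  have m: "x k \<le> x l" if "1 \<le> k" "k \<le> l" "l \<le> d" for k l
    using assms(1) that by (auto simp: simplex_pts_iff)
  have "coface d i x = (\<lambda>j \<in> {1..d + 1}.
     if i = 0 then (if j = 1 then 0 else x (j - 1))
     else if i = d + 1 then (if j = d + 1 then 1 else x j)
     else (if j \<le> i then x j else x (j - 1)))" using assms(1) by (simp add: coface_def)
  then show ?thesis
    using assms(2) by (auto simp: simplex_pts_iff intro!: x m)
qed

lemma codegeneracy_in_simplex: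
  assumes "x \<in> simplex_pts (d + 1)" "1 \<le> i" "i \<le> d + 1"
  shows "codegeneracy d i x \<in> simplex_pts d"
  using assms by (auto simp: simplex_pts_iff codegeneracy_def)

text \<open>The inner cofaces repeat a coordinate; the two outer ones insert 0 or 1, which is why
  \<open>\<theta>\<close> has to fix the endpoints.\<close>

lemma coface_apply_pt:
  assumes "x \<in> simplex_pts d" "interval_map \<theta>" "i \<le> d + 1"
  shows "coface d i (apply_pt d \<theta> x) = apply_pt (d + 1) \<theta> (coface d i x)"
  using assms apply_pt_in_simplex[OF assms(2,1)]
  by (auto simp: coface_def apply_pt_def interval_map_def fun_eq_iff)

lemma codegeneracy_apply_pt:
  assumes "x \<in> simplex_pts (d + 1)" "interval_map \<theta>" "1 \<le> i" "i \<le> d + 1"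
  shows "codegeneracy d i (apply_pt (d + 1) \<theta> x) = apply_pt d \<theta> (codegeneracy d i x)"
  using assms apply_pt_in_simplex[OF assms(2,1)]
  by (auto simp: codegeneracy_def apply_pt_def fun_eq_iff)

text \<open>Membership and commutation go through one induction, since the coface or codegeneracy
  step commutes only at a point \<open>f x\<close> already known to lie in the simplex.\<close>

lemma simplex_hom_apply_pt:
  assumes "simplex_hom d e \<tau>" "x \<in> simplex_pts d"
  shows "\<tau> x \<in> simplex_pts e"
    and "interval_map \<theta> \<Longrightarrow> apply_pt e \<theta> (\<tau> x) = \<tau> (apply_pt d \<theta> x)"
proof -
  have "\<tau> x \<in> simplex_pts e \<and> (interval_map \<theta> \<longrightarrow> apply_pt e \<theta> (\<tau> x) = \<tau> (apply_pt d \<theta> x))"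
    using assms
  proof (induction rule: simplex_hom.induct)
    case (ident d)
    then show ?case using apply_pt_in_simplex by simp
  next
    case (coface c d f i)
    then have fx: "f x \<in> simplex_pts d"
      and f: "interval_map \<theta> \<longrightarrow> apply_pt d \<theta> (f x) = f (apply_pt c \<theta> x)" by auto
    show ?case
      using coface_in_simplex[OF fx coface(2)] coface_apply_pt[OF fx _ coface(2), of \<theta>] f
        apply_pt_in_simplex[OF _ coface(4), of \<theta>] coface(4)
      by (auto simp: compose_eq)
  next
    case (codegeneracy c d f i)
    then have fx: "f x \<in> simplex_pts (d + 1)"
      and f: "interval_map \<theta> \<longrightarrow> apply_pt (d + 1) \<theta> (f x) = f (apply_pt c \<theta> x)" by auto
    show ?case
      using codegeneracy_in_simplex[OF fx codegeneracy(2,3)]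
        codegeneracy_apply_pt[OF fx _ codegeneracy(2,3), of \<theta>] f
        apply_pt_in_simplex[OF _ codegeneracy(5), of \<theta>] codegeneracy(5)
      by (auto simp: compose_eq)
  qed
  then show "\<tau> x \<in> simplex_pts e" "interval_map \<theta> \<Longrightarrow> apply_pt e \<theta> (\<tau> x) = \<tau> (apply_pt d \<theta> x)"
    by auto
qed

section \<open>Comparison of scalar evaluation with valuations\<close>

text \<open>A valuation is an arbitrary function on sources, but its equations force each coordinate
  on every edge that has a derivation. This is the uniqueness behind the definition of
  \<open>Phi\<close>.\<close>

lemma valuation_carries:
  assumes "carries D a s y" "valuation d D xs v" "k \<in> {1..d}" "\<And>i. i < sh_in (fst D) \<Longrightarrow> a i = xs i k"
  shows "v s k = y"
  using assms(1)
proof (induction rule: carries.induct)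
  case (ext i)
  then show ?case using assms by (simp add: valuation_def)
next
  case (vert u j ys)
  have "v (VertOut u j) k = gen_fun (sh_gen (fst D) u) (snd D u) (\<lambda>i. v (sh_wire (fst D) (VertIn u i)) k) j"
    using assms vert by (simp add: valuation_def gen_act_eq_gen_fun)
  also have "\<dots> = gen_fun (sh_gen (fst D) u) (snd D u) ys j"
    using vert by (intro gen_fun_cong) auto
  finally show ?case .
qed

lemma valuation_extensional:
  assumes "carries D a s y" "valuation d D xs v" "\<And>i. i < sh_in (fst D) \<Longrightarrow> xs i \<in> extensional {1..d}"
  shows "v s \<in> extensional {1..d}"
  using assms(1)
proof cases
  case (ext i)
  then show ?thesis using assms by (simp add: valuation_def)
next
  case (vert u j ys)
  then show ?thesis using assms by (simp add: valuation_def gen_act_eq_gen_fun)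
qed

definition canonical_valuation :: "nat \<Rightarrow> diagram \<Rightarrow> point \<Rightarrow> source \<Rightarrow> point" where
  "canonical_valuation d D x s = (\<lambda>k\<in>{1..d}. edge_val D (\<lambda>_. x k) s)"

lemma valuation_canonical:
  assumes D: "evaluable D" "sh_in (fst D) = 1" and x: "x \<in> simplex_pts d"
  shows "valuation d D (\<lambda>j\<in>{..<1}. x) (canonical_valuation d D x)"
  unfolding valuation_def
proof (intro conjI allI ballI impI)
  fix i assume i: "i < sh_in (fst D)"
  have "edge_val D (\<lambda>_. x k) (ExtIn i) = x k" for k
    using carries.ext[OF i] by (rule edge_val_eqI)
  then have "canonical_valuation d D x (ExtIn i) = (\<lambda>k\<in>{1..d}. x k)"
    by (simp add: canonical_valuation_def)
  also have "\<dots> = x" using x by (intro extensional_restrict) (simp add: simplex_pts_iff)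
  finally show "canonical_valuation d D x (ExtIn i) = (\<lambda>j\<in>{..<1}. x) i"
    using i D by simp
next
  fix u j assume u: "u \<in> sh_verts (fst D)" and j: "j < gen_out (sh_gen (fst D) u)"
  have "edge_val D (\<lambda>_. x k) (VertOut u j) = gen_fun (sh_gen (fst D) u) (snd D u)
      (\<lambda>i. edge_val D (\<lambda>_. x k) (sh_wire (fst D) (VertIn u i))) j" for k
    using u j by (intro edge_val_eqI carries.vert carries_edge_val D) auto
  then show "canonical_valuation d D x (VertOut u j) = gen_act d (sh_gen (fst D) u) (snd D u)
      (\<lambda>i. canonical_valuation d D x (sh_wire (fst D) (VertIn u i))) j"
    unfolding gen_act_eq_gen_fun[OF j] by (auto simp: canonical_valuation_def)
qed

text \<open>Justifies the definite description: the canonical valuation of \<open>D\<close> supplies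
  a value, and any valuation of any other representative is compared with it through
  \<open>same_action\<close>.\<close>

lemma Phi_st_class:
  assumes D: "st_eq D D" "sh_in (fst D) = 1" and x: "x \<in> simplex_pts d"
  shows "Phi d (st_class D) (\<lambda>j\<in>{..<1}. x) = (\<lambda>i\<in>{..<sh_out (fst D)}. apply_pt d (profile D i) x)"
  unfolding Phi_def
proof (rule the_equality)
  have "valuation d D (\<lambda>j\<in>{..<1}. x) (canonical_valuation d D x)"
    using st_eq_evaluable[OF D(1)] D x by (intro valuation_canonical)
  then show "\<exists>E\<in>st_class D. \<exists>v. valuation d E (\<lambda>j\<in>{..<1}. x) v \<and>
      (\<lambda>i\<in>{..<sh_out (fst D)}. apply_pt d (profile D i) x)
        = (\<lambda>j\<in>{..<sh_out (fst E)}. v (sh_wire (fst E) (ExtOut j)))"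
    using st_class_refl[OF D(1)]
    by (intro bexI[of _ D] exI[of _ "canonical_valuation d D x"])
      (auto simp: canonical_valuation_def apply_pt_def profile_def)
next
  fix ys
  assume "\<exists>E\<in>st_class D. \<exists>v. valuation d E (\<lambda>j\<in>{..<1}. x) v \<and>
      ys = (\<lambda>j\<in>{..<sh_out (fst E)}. v (sh_wire (fst E) (ExtOut j)))"
  then obtain E v where E: "st_eq D E" and v: "valuation d E (\<lambda>j\<in>{..<1}. x) v"
    and ys: "ys = (\<lambda>j\<in>{..<sh_out (fst E)}. v (sh_wire (fst E) (ExtOut j)))"
    by (auto simp: st_class_def)
  have same: "same_action D E" using E by (rule st_eq_imp_same_action)
  then have io: "sh_in (fst E) = 1" "sh_out (fst E) = sh_out (fst D)" and ev: "evaluable E"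
    using D by (auto simp: same_action_def)
  have "v (sh_wire (fst E) (ExtOut j)) = apply_pt d (profile D j) x" if j: "j < sh_out (fst D)" for j
  proof (rule extensionalityI[of _ "{1..d}"])
    have c: "carries E a (sh_wire (fst E) (ExtOut j)) (out_val E a j)" for a
      using carries_out_val[OF ev] j io by simp
    show "v (sh_wire (fst E) (ExtOut j)) \<in> extensional {1..d}"
      using x io by (intro valuation_extensional[OF c v]) (auto simp: simplex_pts_iff)
    show "apply_pt d (profile D j) x \<in> extensional {1..d}" by (simp add: apply_pt_def)
    fix k assume k: "k \<in> {1..d}"
    have "x k \<in> {0..1}" using x k by (simp add: simplex_pts_iff)
    then have "out_val D (\<lambda>_. x k) j = out_val E (\<lambda>_. x k) j"
      using same j by (simp add: same_action_def)
    then show "v (sh_wire (fst E) (ExtOut j)) k = apply_pt d (profile D j) x k"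
      using valuation_carries[OF c v k] k io by (simp add: apply_pt_def profile_def)
  qed
  then show "ys = (\<lambda>i\<in>{..<sh_out (fst D)}. apply_pt d (profile D i) x)"
    using io by (auto simp: ys)
qed

subsection \<open>Geometric realizations\<close>

definition gpoints :: "'g sset \<Rightarrow> 'g gpoint set" where
  "gpoints \<Gamma> = {((d, \<gamma>), x) | d \<gamma> x. \<gamma> \<in> s_cells \<Gamma> d \<and> x \<in> simplex_pts d}"

definition lift_pt :: "(real \<Rightarrow> real) \<Rightarrow> 'g gpoint \<Rightarrow> 'g gpoint" where
  "lift_pt \<theta> = (\<lambda>((d, \<gamma>), x). ((d, \<gamma>), apply_pt d \<theta> x))"

lemma lift_pt_simp [simp]: "lift_pt \<theta> ((d, \<gamma>), x) = ((d, \<gamma>), apply_pt d \<theta> x)"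
  by (simp add: lift_pt_def)

lemma geom_class_eq_iff: "geom_class \<Gamma> a = geom_class \<Gamma> b \<longleftrightarrow> equivclp (glue \<Gamma>) a b"
proof
  assume "geom_class \<Gamma> a = geom_class \<Gamma> b"
  then have "b \<in> geom_class \<Gamma> a" by (simp add: geom_class_def)
  then show "equivclp (glue \<Gamma>) a b" by (simp add: geom_class_def)
next
  assume ab: "equivclp (glue \<Gamma>) a b"
  show "geom_class \<Gamma> a = geom_class \<Gamma> b"
    unfolding geom_class_def
    using equivclp_trans[OF ab] equivclp_trans[OF equivclp_sym[OF ab]] by (intro Collect_cong iffI)
qed

lemma glue_gpoints:
  assumes "simplicial_set \<Gamma>" "glue \<Gamma> a b"
  shows "a \<in> gpoints \<Gamma>" "b \<in> gpoints \<Gamma>"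
proof -
  obtain d e \<tau> \<gamma> x where *: "simplex_hom d e \<tau>" "\<gamma> \<in> s_cells \<Gamma> e" "x \<in> simplex_pts d"
    "a = ((d, s_pull \<Gamma> d e \<tau> \<gamma>), x)" "b = ((e, \<gamma>), \<tau> x)"
    using assms(2) unfolding glue_def by blast
  then have "s_pull \<Gamma> d e \<tau> \<gamma> \<in> s_cells \<Gamma> d"
    using assms(1) by (auto simp: simplicial_set_def)
  then show "a \<in> gpoints \<Gamma>" "b \<in> gpoints \<Gamma>"
    using * simplex_hom_apply_pt(1)[OF *(1,3)] by (auto simp: gpoints_def)
qed

text \<open>\<open>U_Phi\<close> ranges over all members of a class; this keeps them inside
  simplices, where \<open>Phi_st_class\<close> is valid.\<close>

lemma equivclp_gpoints:
  assumes "simplicial_set \<Gamma>" "equivclp (glue \<Gamma>) a b" "a \<in> gpoints \<Gamma>"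
  shows "b \<in> gpoints \<Gamma>"
  using assms(2,3) by (induction rule: equivclp_induct) (auto dest: glue_gpoints[OF assms(1)])

text \<open>The cell is unchanged and \<open>\<tau>\<close> commutes with the action of
  \<open>\<theta>\<close>, so the same morphism witnesses the new gluing.\<close>

lemma glue_lift_pt:
  assumes "glue \<Gamma> a b" "interval_map \<theta>"
  shows "glue \<Gamma> (lift_pt \<theta> a) (lift_pt \<theta> b)"
proof -
  obtain d e \<tau> \<gamma> x where *: "simplex_hom d e \<tau>" "\<gamma> \<in> s_cells \<Gamma> e" "x \<in> simplex_pts d"
    "a = ((d, s_pull \<Gamma> d e \<tau> \<gamma>), x)" "b = ((e, \<gamma>), \<tau> x)"
    using assms(1) unfolding glue_def by blast
  then show ?thesis
    using simplex_hom_apply_pt(2)[OF *(1,3) assms(2)] apply_pt_in_simplex[OF assms(2) *(3)]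
    unfolding glue_def by (intro exI[of _ d] exI[of _ e] exI[of _ \<tau>] exI[of _ \<gamma>] exI[of _ "apply_pt d \<theta> x"]) simp
qed

text \<open>A zigzag of gluings is mapped to a zigzag, so generating steps suffice. Used for the
  coordinatewise action, with \<open>\<Gamma>'\<close> equal to \<open>\<Gamma>\<close>, and for the
  map induced by a simplicial map.\<close>

lemma geom_class_map:
  assumes "\<And>a b. glue \<Gamma> a b \<Longrightarrow> glue \<Gamma>' (f a) (f b)" "geom_class \<Gamma> a = geom_class \<Gamma> b"
  shows "geom_class \<Gamma>' (f a) = geom_class \<Gamma>' (f b)"
proof -
  have "equivclp (glue \<Gamma>) a b" using assms(2) by (simp add: geom_class_eq_iff)
  then have "equivclp (glue \<Gamma>') (f a) (f b)"
  proof (induction rule: equivclp_induct)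
    case base
    show ?case by (rule equivclp_refl)
  next
    case (step y z)
    from step(2) have "equivclp (glue \<Gamma>') (f y) (f z)"
      by (auto dest: assms(1) intro: r_into_equivclp converse_r_into_equivclp)
    with step(3) show ?case by (rule equivclp_trans)
  qed
  then show ?thesis by (simp add: geom_class_eq_iff)
qed

lemma geom_class_lift_pt:
  "interval_map \<theta> \<Longrightarrow> geom_class \<Gamma> a = geom_class \<Gamma> b \<Longrightarrow>
     geom_class \<Gamma> (lift_pt \<theta> a) = geom_class \<Gamma> (lift_pt \<theta> b)"
  by (rule geom_class_map) (rule glue_lift_pt)

lemma lift_pt_gpoints: "interval_map \<theta> \<Longrightarrow> a \<in> gpoints \<Gamma> \<Longrightarrow> lift_pt \<theta> a \<in> gpoints \<Gamma>"
  by (auto simp: gpoints_def apply_pt_in_simplex)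

text \<open>Well-definedness: \<open>Phi_st_class\<close> removes the choice of a diagram, and
  profiles, being interval maps, act on classes, which removes the choice of a point.\<close>

lemma U_Phi_geom_class:
  assumes \<Gamma>: "simplicial_set \<Gamma>" and D: "st_eq D D" "sh_in (fst D) = 1" and a: "a \<in> gpoints \<Gamma>"
  shows "U_Phi \<Gamma> (sh_out (fst D)) (st_class D) (geom_class \<Gamma> a)
           = (\<lambda>i\<in>{..<sh_out (fst D)}. geom_class \<Gamma> (lift_pt (profile D i) a))"
  unfolding U_Phi_def
proof (rule the_equality)
  obtain d \<gamma> x where "a = ((d, \<gamma>), x)" "x \<in> simplex_pts d" using a by (auto simp: gpoints_def)
  moreover have "a \<in> geom_class \<Gamma> a" by (simp add: geom_class_def)
  ultimately show "\<exists>d \<gamma> x. ((d, \<gamma>), x) \<in> geom_class \<Gamma> a \<and>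
      (\<lambda>i\<in>{..<sh_out (fst D)}. geom_class \<Gamma> (lift_pt (profile D i) a)) =
      (\<lambda>i\<in>{..<sh_out (fst D)}. geom_class \<Gamma> ((d, \<gamma>), Phi d (st_class D) (\<lambda>j\<in>{..<1}. x) i))"
    using Phi_st_class[OF D] by (intro exI[of _ d] exI[of _ \<gamma>] exI[of _ x]) (auto intro!: restrict_ext)
next
  fix ys
  assume "\<exists>d \<gamma> x. ((d, \<gamma>), x) \<in> geom_class \<Gamma> a \<and>
      ys = (\<lambda>i\<in>{..<sh_out (fst D)}. geom_class \<Gamma> ((d, \<gamma>), Phi d (st_class D) (\<lambda>j\<in>{..<1}. x) i))"
  then obtain d \<gamma> x where b: "((d, \<gamma>), x) \<in> geom_class \<Gamma> a"
    and ys: "ys = (\<lambda>i\<in>{..<sh_out (fst D)}. geom_class \<Gamma> ((d, \<gamma>), Phi d (st_class D) (\<lambda>j\<in>{..<1}. x) i))"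
    by blast
  then have eq: "geom_class \<Gamma> a = geom_class \<Gamma> ((d, \<gamma>), x)"
    by (simp add: geom_class_eq_iff) (simp add: geom_class_def)
  then have "((d, \<gamma>), x) \<in> gpoints \<Gamma>"
    using equivclp_gpoints[OF \<Gamma> _ a] by (simp add: geom_class_eq_iff)
  then have x: "x \<in> simplex_pts d" by (simp add: gpoints_def)
  have "geom_class \<Gamma> (lift_pt (profile D i) a) = geom_class \<Gamma> (lift_pt (profile D i) ((d, \<gamma>), x))"
    if "i < sh_out (fst D)" for i
    using interval_map_profile[OF st_eq_evaluable[OF D(1)] that] eq by (rule geom_class_lift_pt)
  then show "ys = (\<lambda>i\<in>{..<sh_out (fst D)}. geom_class \<Gamma> (lift_pt (profile D i) a))"
    using Phi_st_class[OF D x] unfolding ys by (intro restrict_ext) simp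
qed

definition map_gpoint :: "(nat \<Rightarrow> 'g \<Rightarrow> 'h) \<Rightarrow> 'g gpoint \<Rightarrow> 'h gpoint" where
  "map_gpoint F = (\<lambda>((d, \<gamma>), x). ((d, F d \<gamma>), x))"

lemma geom_map_geom_class:
  assumes "simplicial_map \<Gamma> \<Gamma>' F"
  shows "geom_map \<Gamma>' F (geom_class \<Gamma> a) = geom_class \<Gamma>' (map_gpoint F a)"
proof -
  have glue: "glue \<Gamma>' (map_gpoint F a) (map_gpoint F b)" if ab: "glue \<Gamma> a b" for a b
  proof -
    obtain d e \<tau> \<gamma> x where *: "simplex_hom d e \<tau>" "\<gamma> \<in> s_cells \<Gamma> e" "x \<in> simplex_pts d"
      "a = ((d, s_pull \<Gamma> d e \<tau> \<gamma>), x)" "b = ((e, \<gamma>), \<tau> x)"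
      using ab unfolding glue_def by blast
    then have "F e \<gamma> \<in> s_cells \<Gamma>' e" "F d (s_pull \<Gamma> d e \<tau> \<gamma>) = s_pull \<Gamma>' d e \<tau> (F e \<gamma>)"
      using assms by (auto simp: simplicial_map_def)
    then show ?thesis
      using * unfolding glue_def
      by (intro exI[of _ d] exI[of _ e] exI[of _ \<tau>] exI[of _ "F e \<gamma>"] exI[of _ x]) (simp add: map_gpoint_def)
  qed
  have "geom_class \<Gamma>' (map_gpoint F b) = geom_class \<Gamma>' (map_gpoint F a)" if "b \<in> geom_class \<Gamma> a" for b
  proof (rule geom_class_map[of \<Gamma>, OF glue])
    have "equivclp (glue \<Gamma>) a b" using that by (simp add: geom_class_def)
    then show "geom_class \<Gamma> b = geom_class \<Gamma> a"
      unfolding geom_class_eq_iff by (rule equivclp_sym)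
  qed
  moreover have "a \<in> geom_class \<Gamma> a" by (simp add: geom_class_def)
  ultimately have "(\<Union>b\<in>geom_class \<Gamma> a. geom_class \<Gamma>' (map_gpoint F b)) = geom_class \<Gamma>' (map_gpoint F a)"
    by (intro UN_constant_eq[of a] ballI)
  then show ?thesis by (simp add: geom_map_def map_gpoint_def case_prod_unfold)
qed

subsection \<open>The coalgebra relations\<close>

lemma topspace_quotient_topology [simp]: "topspace (quotient_topology X q) = q ` topspace X"
proof
  show "topspace (quotient_topology X q) \<subseteq> q ` topspace X"
    using openin_topspace[of "quotient_topology X q"] unfolding openin_quotient_topology by blast
  have "{x \<in> topspace X. q x \<in> q ` topspace X} = topspace X" by auto
  then show "q ` topspace X \<subseteq> topspace (quotient_topology X q)"
    by (intro openin_subset) (simp add: openin_quotient_topology)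
qed

lemma cw_points_osp: "cw_points (osp (U_operad St) m) = st_class ` diagrams 1 m"
proof -
  have "params S \<subseteq> topspace (powertop_real (cell_verts S))" for S
    unfolding params_def topspace_product_topology by (intro PiE_mono) simp
  then have "(SIGMA S:shapes 1 m. topspace (subtopology (powertop_real (cell_verts S)) (params S))) = diagrams 1 m"
    unfolding topspace_subtopology Int_absorb1 by (auto simp: diagrams_def Int_absorb1)
  then show ?thesis by (simp add: U_operad_def St_def st_hom_def comp_def)
qed

lemma topspace_simplex: "topspace (cw_top (simplex_cw d)) = simplex_pts d"
proof -
  have "simplex_pts d \<subseteq> (\<Pi>\<^sub>E i\<in>{1..d}. {0..1})" by (simp add: simplex_pts_def)
  also have "\<dots> \<subseteq> topspace (powertop_real {1..d})"
    unfolding topspace_product_topology by (intro PiE_mono) simp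
  finally show ?thesis by (simp add: simplex_cw_def Int_absorb1)
qed

lemma cw_points_geom: "cw_points (geom \<Gamma>) = geom_class \<Gamma> ` gpoints \<Gamma>"
proof -
  have "Sigma (SIGMA d:UNIV. s_cells \<Gamma> d) (topspace \<circ> (\<lambda>(d, \<gamma>). cw_top (simplex_cw d))) = gpoints \<Gamma>"
    by (auto simp: gpoints_def topspace_simplex)
  then show ?thesis by (simp add: geom_def)
qed

lemma osp_pointE:
  assumes "g \<in> cw_points (osp (U_operad St) m)"
  obtains D where "D \<in> diagrams 1 m" "g = st_class D" "st_eq D D" "sh_in (fst D) = 1" "sh_out (fst D) = m"
proof -
  obtain D where D: "D \<in> diagrams 1 m" "g = st_class D" using assms by (auto simp: cw_points_osp)
  then have "sh_in (fst D) = 1" "sh_out (fst D) = m" by (auto simp: diagrams_def shapes_def)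
  then show ?thesis using that D st_eq_refl by blast
qed

lemma geom_pointE:
  assumes "c \<in> cw_points (geom \<Gamma>)"
  obtains a where "a \<in> gpoints \<Gamma>" "c = geom_class \<Gamma> a"
  using assms by (auto simp: cw_points_geom)

lemma apply_pt_compose: "apply_pt d \<theta> (apply_pt d \<eta> x) = apply_pt d (\<theta> \<circ> \<eta>) x"
  by (auto simp: apply_pt_def)

lemma lift_pt_compose: "lift_pt \<theta> (lift_pt \<eta> a) = lift_pt (\<theta> \<circ> \<eta>) a"
  by (auto simp: lift_pt_def apply_pt_compose split: prod.split)

lemma apply_pt_ident: "x \<in> simplex_pts d \<Longrightarrow> apply_pt d (\<lambda>t. t) x = x"
  unfolding apply_pt_def by (intro extensional_restrict) (simp add: simplex_pts_iff)

lemma lift_pt_ident: "a \<in> gpoints \<Gamma> \<Longrightarrow> lift_pt (\<lambda>t. t) a = a"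
  by (auto simp: gpoints_def apply_pt_ident)

section \<open>The formula on representatives, naturality and the axioms\<close>

lemma U_Phi_Phi:
  assumes "simplicial_set \<Gamma>" "g \<in> cw_points (osp (U_operad St) m)" "\<gamma> \<in> s_cells \<Gamma> d" "x \<in> simplex_pts d"
  shows "U_Phi \<Gamma> m g (geom_class \<Gamma> ((d, \<gamma>), x))
           = (\<lambda>i\<in>{..<m}. geom_class \<Gamma> ((d, \<gamma>), Phi d g (\<lambda>j\<in>{..<1}. x) i))"
proof -
  obtain D where D: "g = st_class D" "st_eq D D" "sh_in (fst D) = 1" "sh_out (fst D) = m"
    using assms(2) by (rule osp_pointE)
  have "((d, \<gamma>), x) \<in> gpoints \<Gamma>" using assms by (simp add: gpoints_def)
  from U_Phi_geom_class[OF assms(1) D(2,3) this] show ?thesis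
    unfolding D(1) D(4) Phi_st_class[OF D(2,3) assms(4)] by (auto intro!: restrict_ext)
qed

text \<open>A simplicial map changes only the label of the cell and the action only the coordinates,
  so the two commute on representatives.\<close>

lemma U_Phi_natural:
  assumes \<Gamma>: "simplicial_set \<Gamma>" "simplicial_set \<Gamma>'" and F: "simplicial_map \<Gamma> \<Gamma>' F"
    and g: "g \<in> cw_points (osp (U_operad St) m)" and c: "c \<in> cw_points (geom \<Gamma>)"
  shows "U_Phi \<Gamma>' m g (geom_map \<Gamma>' F c) = (\<lambda>i\<in>{..<m}. geom_map \<Gamma>' F (U_Phi \<Gamma> m g c i))"
proof -
  obtain D where D: "g = st_class D" "st_eq D D" "sh_in (fst D) = 1" "sh_out (fst D) = m"
    using g by (rule osp_pointE)
  obtain a where a: "a \<in> gpoints \<Gamma>" "c = geom_class \<Gamma> a" using c by (rule geom_pointE)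
  have "map_gpoint F a \<in> gpoints \<Gamma>'"
  proof -
    have "F d \<gamma> \<in> s_cells \<Gamma>' d" if "\<gamma> \<in> s_cells \<Gamma> d" for d \<gamma>
      using F that unfolding simplicial_map_def by blast
    then show ?thesis using a(1) by (auto simp: gpoints_def map_gpoint_def)
  qed
  moreover have "lift_pt \<theta> (map_gpoint F a) = map_gpoint F (lift_pt \<theta> a)" for \<theta>
    by (simp add: lift_pt_def map_gpoint_def split: prod.split)
  ultimately show ?thesis
    using U_Phi_geom_class[OF \<Gamma>(1) D(2,3) a(1)] U_Phi_geom_class[OF \<Gamma>(2) D(2,3), of "map_gpoint F a"]
    unfolding D(1,4) a(2) by (auto simp: geom_map_geom_class[OF F] intro!: restrict_ext)
qed

text \<open>With representatives \<open>Ds\<close> for \<open>gs\<close>, the operadic composite is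
  the class of \<open>d_comp (tensor Ds) D\<close>. Its outputs in block \<open>i\<close> have
  composites with \<open>profile D i\<close> as profiles, and associativity becomes
  \<open>lift_pt_compose\<close>.\<close>

lemma U_Phi_assoc:
  assumes \<Gamma>: "simplicial_set \<Gamma>" and len: "length ks = m" "length gs = m"
    and g: "g \<in> cw_points (osp (U_operad St) m)"
    and gs: "\<forall>i<m. gs ! i \<in> cw_points (osp (U_operad St) (ks ! i))"
    and c: "c \<in> cw_points (geom \<Gamma>)" and i: "i < m" and j: "j < ks ! i"
  shows "U_Phi \<Gamma> (sum_list ks) (ocomp (U_operad St) g gs) c (sum_list (take i ks) + j)
           = U_Phi \<Gamma> (ks ! i) (gs ! i) (U_Phi \<Gamma> m g c i) j"
proof -
  obtain D where D: "g = st_class D" "st_eq D D" "sh_in (fst D) = 1" "sh_out (fst D) = m"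
    using g by (rule osp_pointE)
  obtain a where a: "a \<in> gpoints \<Gamma>" "c = geom_class \<Gamma> a" using c by (rule geom_pointE)
  have "\<forall>i\<in>{..<m}. \<exists>E. gs ! i = st_class E \<and> st_eq E E \<and> sh_in (fst E) = 1 \<and> sh_out (fst E) = ks ! i"
  proof
    fix i assume "i \<in> {..<m}"
    with gs have "gs ! i \<in> cw_points (osp (U_operad St) (ks ! i))" by simp
    then obtain E where "gs ! i = st_class E" "st_eq E E" "sh_in (fst E) = 1" "sh_out (fst E) = ks ! i"
      by (rule osp_pointE)
    then show "\<exists>E. gs ! i = st_class E \<and> st_eq E E \<and> sh_in (fst E) = 1 \<and> sh_out (fst E) = ks ! i"
      by (intro exI conjI)
  qed
  then obtain f where f: "\<forall>i\<in>{..<m}. gs ! i = st_class (f i) \<and> st_eq (f i) (f i) \<and> sh_in (fst (f i)) = 1 \<and>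
      sh_out (fst (f i)) = ks ! i"
    by (rule bchoice[THEN exE])
  define Ds where "Ds = map f [0..<m]"
  have Ds: "length Ds = m" "gs = map st_class Ds" "ks = map (\<lambda>D. sh_out (fst D)) Ds"
    using f len by (simp add: Ds_def) (intro nth_equalityI; use f len in \<open>simp add: Ds_def\<close>)+
  have refl: "\<forall>D\<in>set Ds. st_eq D D \<and> sh_in (fst D) = 1" using f by (auto simp: Ds_def)
  let ?E = "d_comp (tensor Ds) D"
  have T: "st_eq (tensor Ds) (tensor Ds)" "sh_in (fst (tensor Ds)) = m" "sh_out (fst (tensor Ds)) = sum_list ks"
    using refl Ds by (simp_all add: st_eq_tensor sh_in_tensor sh_out_tensor)
  have E: "st_eq ?E ?E" "sh_in (fst ?E) = 1" "sh_out (fst ?E) = sum_list ks"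
    using st_eq.comp[OF T(1) D(2)] T D by simp_all
  have comp: "ocomp (U_operad St) (st_class D) gs = st_class ?E"
    using refl T D by (simp add: U_operad_def Ds(2) foldr_ptimes_st_class pcomp_st_class)
  let ?n = "sum_list (take i ks) + j"
  have n: "?n < sum_list ks" using i j len by (intro sum_list_take_add_less) auto
  have Di: "st_eq (Ds ! i) (Ds ! i)" "sh_in (fst (Ds ! i)) = 1" "sh_out (fst (Ds ! i)) = ks ! i" "gs ! i = st_class (Ds ! i)"
    using f i by (auto simp: Ds_def)
  have "profile ?E ?n t = profile (Ds ! i) j (profile D i t)" for t
  proof -
    have "profile ?E ?n t = out_val (tensor Ds) (out_val D (\<lambda>_. t)) ?n"
      unfolding profile_def using T D n by (intro out_val_comp st_eq_evaluable) auto
    also have "\<dots> = out_val (Ds ! i) (\<lambda>_. out_val D (\<lambda>_. t) i) j"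
      unfolding Ds(3) using refl i j Ds(1) Di(3) by (intro out_val_tensor) auto
    finally show ?thesis by (simp add: profile_def)
  qed
  then have "profile ?E ?n = profile (Ds ! i) j \<circ> profile D i" by auto
  moreover have "lift_pt (profile D i) a \<in> gpoints \<Gamma>"
    using interval_map_profile[OF st_eq_evaluable[OF D(2)], of i] i D(4) a(1) by (intro lift_pt_gpoints) auto
  ultimately show ?thesis
    using U_Phi_geom_class[OF \<Gamma> E(1,2) a(1)] U_Phi_geom_class[OF \<Gamma> D(2,3) a(1)]
      U_Phi_geom_class[OF \<Gamma> Di(1,2), of "lift_pt (profile D i) a"] i j n
    unfolding comp E(3) D(1,4) Di(3,4) a(2) by (simp add: lift_pt_compose)
qed

text \<open>Output \<open>j\<close> of \<open>d_perm m \<sigma>\<close> is wired to input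
  \<open>inv \<sigma> j\<close>, so post-composition permutes the profiles accordingly.\<close>

lemma U_Phi_equivariant:
  assumes \<Gamma>: "simplicial_set \<Gamma>" and \<sigma>: "\<sigma> permutes {..<m}"
    and g: "g \<in> cw_points (osp (U_operad St) m)" and c: "c \<in> cw_points (geom \<Gamma>)"
  shows "U_Phi \<Gamma> m (osym (U_operad St) m \<sigma> g) c = (\<lambda>j\<in>{..<m}. U_Phi \<Gamma> m g c (inv \<sigma> j))"
proof -
  obtain D where D: "g = st_class D" "st_eq D D" "sh_in (fst D) = 1" "sh_out (fst D) = m"
    using g by (rule osp_pointE)
  obtain a where a: "a \<in> gpoints \<Gamma>" "c = geom_class \<Gamma> a" using c by (rule geom_pointE)
  have P: "st_eq (d_perm m \<sigma>) (d_perm m \<sigma>)" using diagram_perm[OF \<sigma>] by (rule st_eq_refl)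
  let ?E = "d_comp (d_perm m \<sigma>) D"
  have E: "st_eq ?E ?E" "sh_in (fst ?E) = 1" "sh_out (fst ?E) = m"
    using st_eq.comp[OF P D(2)] D by simp_all
  have sym: "osym (U_operad St) m \<sigma> (st_class D) = st_class ?E"
  proof -
    have "osym (U_operad St) m \<sigma> (st_class D) = pcomp St (st_class (d_perm m \<sigma>)) (st_class D)"
      by (simp add: U_operad_def) (simp add: St_def)
    then show ?thesis using P D by (simp add: pcomp_st_class)
  qed
  have "profile ?E j = profile D (inv \<sigma> j)" if "j < m" for j
    using that P D by (auto simp: fun_eq_iff profile_def out_val_comp st_eq_evaluable out_val_perm[OF \<sigma>])
  moreover have "inv \<sigma> j < m" if "j < m" for j
    using permutes_in_image[OF permutes_inv[OF \<sigma>], of j] that by simp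
  ultimately show ?thesis
    using U_Phi_geom_class[OF \<Gamma> E(1,2) a(1)] U_Phi_geom_class[OF \<Gamma> D(2,3) a(1)]
    unfolding sym E(3) D(1,4) a(2) by (auto intro!: restrict_ext)
qed

lemma U_Phi_unit:
  assumes \<Gamma>: "simplicial_set \<Gamma>" and c: "c \<in> cw_points (geom \<Gamma>)"
  shows "U_Phi \<Gamma> 1 (ounit (U_operad St)) c = (\<lambda>j\<in>{..<1}. c)"
proof -
  obtain a where a: "a \<in> gpoints \<Gamma>" "c = geom_class \<Gamma> a" using c by (rule geom_pointE)
  have I: "st_eq (d_id 1) (d_id 1)" "sh_in (fst (d_id 1)) = 1" "sh_out (fst (d_id 1)) = 1"
    using st_eq_refl[OF diagram_id] by simp_all
  have "profile (d_id 1) 0 = (\<lambda>t. t)" by (auto simp: profile_def out_val_id)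
  moreover have "ounit (U_operad St) = st_class (d_id 1)" by (simp add: U_operad_def St_def)
  ultimately show ?thesis
    using U_Phi_geom_class[OF \<Gamma> I(1,2) a(1)] unfolding I(3) a(2)
    by (auto intro!: restrict_ext simp: lift_pt_ident[OF a(1)])
qed

subsection \<open>Cellularity\<close>

text \<open>For a finite set \<open>A\<close> of interior values the rank is 0 at 0, i at the i-th
  element of \<open>A\<close>, and \<open>card A + 1\<close> at 1. Counting 0 along with
  \<open>A\<close> separates 0 from the least interior value.\<close>

definition rank_below :: "real set \<Rightarrow> real \<Rightarrow> nat" where
  "rank_below A t = card {u \<in> insert 0 A. u < t}"

lemma rank_below_mono: "finite A \<Longrightarrow> t \<le> u \<Longrightarrow> rank_below A t \<le> rank_below A u"
  unfolding rank_below_def by (intro card_mono) auto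

lemma rank_below_strict: "finite A \<Longrightarrow> t < u \<Longrightarrow> t \<in> insert 0 A \<Longrightarrow> rank_below A t < rank_below A u"
  unfolding rank_below_def by (intro psubset_card_mono) auto

lemma rank_below_le:
  assumes "finite A" "A \<subseteq> {0<..<1}"
  shows "rank_below A t \<le> card A + 1" and "t \<in> insert 0 A \<Longrightarrow> rank_below A t \<le> card A"
proof -
  have c: "card (insert 0 A) = card A + 1" using assms by (subst card_insert_disjoint) auto
  have "rank_below A t \<le> card (insert 0 A)"
    unfolding rank_below_def using assms by (intro card_mono) auto
  then show "rank_below A t \<le> card A + 1" by (simp add: c)
  assume t: "t \<in> insert 0 A"
  have "rank_below A t \<le> card (insert 0 A - {t})"
    unfolding rank_below_def using assms by (intro card_mono) auto
  also have "\<dots> = card A" using c assms(1) t by (simp only: card_Diff_singleton)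
  finally show "rank_below A t \<le> card A" .
qed

text \<open>The sum of the ranks of the two arguments increases strictly with the value of \<open>psi s\<close>, and
  only the ranks of the values 0 and 1 lie outside \<open>{1..a + b + 1}\<close>.\<close>

lemma card_interior_psi:
  fixes x y :: "nat \<Rightarrow> real"
  assumes s: "s \<in> {0..1}" and K: "finite K"
    and x: "mono_on K x" "x \<in> K \<rightarrow> {0..1}" and y: "mono_on K y" "y \<in> K \<rightarrow> {0..1}"
  shows "card ((\<lambda>k. psi s (x k) (y k)) ` K - {0, 1})
           \<le> card (x ` K - {0, 1}) + card (y ` K - {0, 1}) + 1"
proof -
  define X where "X = x ` K - {0, 1}"
  define Y where "Y = y ` K - {0, 1}"
  have fin: "finite X" "finite Y" using K by (auto simp: X_def Y_def)
  have x01: "0 \<le> x l" "x l \<le> 1" "0 \<le> y l" "y l \<le> 1" if "l \<in> K" for l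
    using x(2) y(2) that by (auto simp: Pi_iff)
  have X01: "X \<subseteq> {0<..<1}" "Y \<subseteq> {0<..<1}"
    using x01 by (auto simp: X_def Y_def less_le)
  define Z where "Z = (\<lambda>k. psi s (x k) (y k)) ` K - {0, 1}"
  have "\<forall>z\<in>Z. \<exists>k\<in>K. z = psi s (x k) (y k)" by (auto simp: Z_def)
  \<comment> \<open>One index is fixed for each value, so that \<open>R\<close> becomes a function
    of the value.\<close>
  then obtain k where k: "\<forall>z\<in>Z. k z \<in> K \<and> z = psi s (x (k z)) (y (k z))"
    unfolding Bex_def by (rule bchoice[THEN exE])
  define R where "R z = rank_below X (x (k z)) + rank_below Y (y (k z))" for z
  have xin: "x l \<in> insert 0 X \<or> x l = 1" "y l \<in> insert 0 Y \<or> y l = 1" if "l \<in> K" for l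
    using that by (auto simp: X_def Y_def)
  have R_less: "R z < R w" if zw: "z \<in> Z" "w \<in> Z" "z < w" for z w
  proof -
    have kz: "k z \<in> K" "k w \<in> K" and less: "psi s (x (k z)) (y (k z)) < psi s (x (k w)) (y (k w))"
      using k zw by simp_all
    \<comment> \<open>Both arguments are nondecreasing in the index and \<open>psi s\<close> is
      monotone, so a larger value can only occur at a larger index.\<close>
    have "k z < k w"
    proof (rule ccontr)
      assume "\<not> k z < k w"
      then have "x (k w) \<le> x (k z)" "y (k w) \<le> y (k z)"
        using mono_onD[OF x(1) kz(2,1)] mono_onD[OF y(1) kz(2,1)] by simp_all
      then show False using psi_mono[OF s, of "x (k w)" "x (k z)" "y (k w)" "y (k z)"] less by simp
    qed
    then have le: "x (k z) \<le> x (k w)" "y (k z) \<le> y (k w)"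
      using mono_onD[OF x(1) kz(1,2)] mono_onD[OF y(1) kz(1,2)] by simp_all
    \<comment> \<open>Equality in both arguments would give equal values of
      \<open>psi s\<close>.\<close>
    have "x (k z) < x (k w) \<or> y (k z) < y (k w)" using le less by (metis less_le)
    then show ?thesis
    proof
      assume lt: "x (k z) < x (k w)"
      then have "x (k z) \<noteq> 1" using x01(2)[OF kz(2)] by linarith
      then have "rank_below X (x (k z)) < rank_below X (x (k w))"
        using xin(1)[OF kz(1)] lt fin by (intro rank_below_strict) auto
      then show ?thesis using rank_below_mono[OF fin(2) le(2)] by (simp add: R_def)
    next
      assume lt: "y (k z) < y (k w)"
      then have "y (k z) \<noteq> 1" using x01(4)[OF kz(2)] by linarith
      then have "rank_below Y (y (k z)) < rank_below Y (y (k w))"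
        using xin(2)[OF kz(1)] lt fin by (intro rank_below_strict) auto
      then show ?thesis using rank_below_mono[OF fin(1) le(1)] by (simp add: R_def)
    qed
  qed
  \<comment> \<open>Lower end: z is not 0, so one argument is positive. Upper end: z is not 1, so at
    most one of the two arguments is 1 and has the top rank.\<close>
  have "R z \<in> {1..card X + card Y + 1}" if z: "z \<in> Z" for z
  proof -
    have kz: "k z \<in> K" "z = psi s (x (k z)) (y (k z))" using k z by auto
    note u = x01[OF kz(1)]
    have "\<not> (x (k z) = 0 \<and> y (k z) = 0)" using z kz(2) by (auto simp: Z_def psi_def)
    then have "x (k z) > 0 \<or> y (k z) > 0" using u by linarith
    then have "rank_below X (x (k z)) > 0 \<or> rank_below Y (y (k z)) > 0"
      using rank_below_strict[OF fin(1), of 0 "x (k z)"] rank_below_strict[OF fin(2), of 0 "y (k z)"] by auto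
    moreover have "\<not> (x (k z) = 1 \<and> y (k z) = 1)" using z kz(2) by (auto simp: Z_def psi_def)
    moreover have "rank_below X (x (k z)) \<le> card X" if "x (k z) \<noteq> 1"
      using xin(1)[OF kz(1)] that rank_below_le(2)[OF fin(1) X01(1)] by blast
    moreover have "rank_below Y (y (k z)) \<le> card Y" if "y (k z) \<noteq> 1"
      using xin(2)[OF kz(1)] that rank_below_le(2)[OF fin(2) X01(2)] by blast
    ultimately show ?thesis
      using rank_below_le(1)[OF fin(1) X01(1), of "x (k z)"] rank_below_le(1)[OF fin(2) X01(2), of "y (k z)"]
      unfolding R_def atLeastAtMost_iff by linarith
  qed
  then have "R ` Z \<subseteq> {1..card X + card Y + 1}" by blast
  moreover have "inj_on R Z" by (rule linorder_inj_onI') (use R_less in force)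
  ultimately have "card Z \<le> card {1..card X + card Y + 1}" by (intro card_inj_on_le) auto
  then show ?thesis by (simp add: X_def Y_def Z_def)
qed

text \<open>The first component sends values up to 1/2 to 0 and the second sends larger ones to 1,
  so each interior value contributes to at most one of them.\<close>

lemma card_interior_Delta:
  assumes "finite A"
  shows "card (pi1_Delta ` A - {0, 1}) + card (pi2_Delta ` A - {0, 1}) \<le> card (A - {0, 1})"
proof -
  have "pi1_Delta ` A - {0, 1} \<subseteq> pi1_Delta ` {t \<in> A - {0, 1}. t > 1/2}"
    by (auto simp: pi1_Delta_def)
  then have "card (pi1_Delta ` A - {0, 1}) \<le> card {t \<in> A - {0, 1}. t > 1/2}"
    using assms by (intro surj_card_le) auto
  moreover have "pi2_Delta ` A - {0, 1} \<subseteq> pi2_Delta ` {t \<in> A - {0, 1}. t \<le> 1/2}"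
    by (auto simp: pi2_Delta_def split: if_splits)
  then have "card (pi2_Delta ` A - {0, 1}) \<le> card {t \<in> A - {0, 1}. t \<le> 1/2}"
    using assms by (intro surj_card_le) auto
  moreover have "card {t \<in> A - {0, 1}. t > 1/2} + card {t \<in> A - {0, 1}. t \<le> 1/2} = card (A - {0, 1})"
    using assms by (subst card_Un_disjoint[symmetric]) (auto intro: arg_cong[where f = card])
  ultimately show ?thesis by linarith
qed

lemma card_interior_gen_fun:
  assumes s: "gen_dim g = 1 \<Longrightarrow> s \<in> {0..1}" and K: "finite (K :: nat set)"
    and x: "\<And>i. i < gen_in g \<Longrightarrow> mono_on K (x i)" "\<And>i. i < gen_in g \<Longrightarrow> x i \<in> K \<rightarrow> {0..1}"
  shows "(\<Sum>j<gen_out g. card ((\<lambda>k. gen_fun g s (\<lambda>i. x i k) j) ` K - {0, 1}))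
           \<le> (\<Sum>i<gen_in g. card (x i ` K - {0, 1})) + gen_dim g"
proof (cases g)
  case GDelta
  have "(\<lambda>k. pi1_Delta (x 0 k)) ` K = pi1_Delta ` x 0 ` K" "(\<lambda>k. pi2_Delta (x 0 k)) ` K = pi2_Delta ` x 0 ` K"
    by auto
  then show ?thesis using card_interior_Delta[of "x 0 ` K"] K by (simp add: GDelta numeral_2_eq_2)
next
  case GMu
  have "card ((\<lambda>k. psi s (x 0 k) (x 1 k)) ` K - {0, 1})
      \<le> card (x 0 ` K - {0, 1}) + card (x 1 ` K - {0, 1}) + 1"
    using assms GMu by (intro card_interior_psi) auto
  then show ?thesis by (simp add: GMu numeral_2_eq_2)
next
  case GH
  have "phi s 0 = 0" "phi s 1 = 1" using s GH by (auto simp: phi_eq_min)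
  \<comment> \<open>As \<open>phi s\<close> fixes 0 and 1, an interior output value comes from an
    interior input value.\<close>
  then have "(\<lambda>k. phi s (x 0 k)) ` K - {0, 1} \<subseteq> phi s ` (x 0 ` K - {0, 1})" by auto
  then have "card ((\<lambda>k. phi s (x 0 k)) ` K - {0, 1}) \<le> card (x 0 ` K - {0, 1})"
    using K by (intro surj_card_le) auto
  then show ?thesis by (simp add: GH)
qed simp

section \<open>Counting over the graph\<close>

text \<open>Serves both targets and sources: external half-edges come from \<open>c\<close>,
  half-edges at vertices from \<open>e\<close>.\<close>

lemma sum_half_edges:
  fixes c :: "nat \<Rightarrow> 'a" and e :: "nat \<Rightarrow> nat \<Rightarrow> 'a" and N :: "'a \<Rightarrow> nat"
  assumes V: "finite V" and inj: "inj c" "inj (\<lambda>(v, j). e v j)" and disj: "\<And>i v j. c i \<noteq> e v j"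
  shows "sum N (c ` {..<n} \<union> {e v j | v j. v \<in> V \<and> j < k v})
           = (\<Sum>i<n. N (c i)) + (\<Sum>v\<in>V. \<Sum>j<k v. N (e v j))"
proof -
  let ?P = "SIGMA v:V. {..<k v}"
  have "{e v j | v j. v \<in> V \<and> j < k v} = (\<lambda>(v, j). e v j) ` ?P" by force
  then have "sum N (c ` {..<n} \<union> {e v j | v j. v \<in> V \<and> j < k v})
      = sum N (c ` {..<n}) + sum N ((\<lambda>(v, j). e v j) ` ?P)"
    using V disj by (simp only:, intro sum.union_disjoint) auto
  also have "sum N (c ` {..<n}) = (\<Sum>i<n. N (c i))"
    using inj(1) by (subst sum.reindex) (auto intro: inj_on_subset)
  also have "sum N ((\<lambda>(v, j). e v j) ` ?P) = (\<Sum>(v, j)\<in>?P. N (e v j))"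
    by (subst sum.reindex[OF inj_on_subset[OF inj(2)]]) (auto intro!: sum.cong)
  also have "\<dots> = (\<Sum>v\<in>V. \<Sum>j<k v. N (e v j))"
    using V by (intro sum.Sigma[symmetric]) auto
  finally show ?thesis .
qed

lemma sum_targets:
  fixes N :: "target \<Rightarrow> nat"
  assumes "finite (sh_verts S)"
  shows "sum N (targets S) = (\<Sum>j<sh_out S. N (ExtOut j)) +
     (\<Sum>v\<in>sh_verts S. \<Sum>i<gen_in (sh_gen S v). N (VertIn v i))"
  unfolding targets_def using assms by (intro sum_half_edges) (auto simp: inj_def)

lemma sum_sources:
  fixes N :: "source \<Rightarrow> nat"
  assumes "finite (sh_verts S)"
  shows "sum N (sources S) = (\<Sum>i<sh_in S. N (ExtIn i)) +
     (\<Sum>v\<in>sh_verts S. \<Sum>j<gen_out (sh_gen S v). N (VertOut v j))"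
  unfolding sources_def using assms by (intro sum_half_edges) (auto simp: inj_def)

text \<open>At each vertex the number of interior coordinates grows by at most its dimension from the incoming
  to the outgoing edges; summing over all vertices, the inner edges cancel.\<close>

lemma sum_card_interior_profile:
  assumes D: "D \<in> diagrams 1 m" and x: "x \<in> simplex_pts d"
  shows "(\<Sum>i<m. card (apply_pt d (profile D i) x ` {1..d} - {0, 1}))
           \<le> card (x ` {1..d} - {0, 1}) + card (cell_verts (fst D))"
proof -
  let ?S = "fst D" and ?K = "{1..d}"
  have S: "finite (sh_verts ?S)" "bij_betw (sh_wire ?S) (targets ?S) (sources ?S)" "sh_in ?S = 1" "sh_out ?S = m"
    using D by (auto simp: diagrams_def shapes_def)
  have ev: "evaluable D" using D by (rule evaluable_diagram)
  then have up: "unit_params D" by (simp add: evaluable_def)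
  define N where "N s = card ((\<lambda>k. edge_val D (\<lambda>_. x k) s) ` ?K - {0, 1})" for s
  have x01: "x k \<in> {0..1}" if "k \<in> ?K" for k using x that by (simp add: simplex_pts_iff)
  have vertex: "(\<Sum>j<gen_out (sh_gen ?S v). N (VertOut v j)) \<le>
      (\<Sum>i<gen_in (sh_gen ?S v). N (sh_wire ?S (VertIn v i))) + gen_dim (sh_gen ?S v)"
    if v: "v \<in> sh_verts ?S" for v
  proof -
    define y where "y i k = edge_val D (\<lambda>_. x k) (sh_wire ?S (VertIn v i))" for i k
    have y: "carries D (\<lambda>_. x k) (sh_wire ?S (VertIn v i)) (y i k)" if "i < gen_in (sh_gen ?S v)" for i k
      unfolding y_def using v that by (intro carries_edge_val[OF ev]) simp
    have "edge_val D (\<lambda>_. x k) (VertOut v j) = gen_fun (sh_gen ?S v) (snd D v) (\<lambda>i. y i k) j"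
      if "j < gen_out (sh_gen ?S v)" for j k
      using v that y by (intro edge_val_eqI carries.vert)
    then have "(\<Sum>j<gen_out (sh_gen ?S v). N (VertOut v j)) =
        (\<Sum>j<gen_out (sh_gen ?S v). card ((\<lambda>k. gen_fun (sh_gen ?S v) (snd D v) (\<lambda>i. y i k) j) ` ?K - {0, 1}))"
      by (simp add: N_def)
    also have "\<dots> \<le> (\<Sum>i<gen_in (sh_gen ?S v). card (y i ` ?K - {0, 1})) + gen_dim (sh_gen ?S v)"
    proof (rule card_interior_gen_fun)
      show "gen_dim (sh_gen ?S v) = 1 \<Longrightarrow> snd D v \<in> {0..1}" using unit_paramsD[OF up v] .
      show "mono_on ?K (y i)" if "i < gen_in (sh_gen ?S v)" for i
        using x by (intro mono_onI carries_mono[OF y[OF that] y[OF that] up]) (simp add: simplex_pts_iff)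
      show "y i \<in> ?K \<rightarrow> {0..1}" if "i < gen_in (sh_gen ?S v)" for i
        using carries_unit[OF y[OF that] up] x01 by blast
    qed simp
    finally show ?thesis by (simp add: N_def y_def[abs_def])
  qed
  have "(\<Sum>v\<in>sh_verts ?S. \<Sum>j<gen_out (sh_gen ?S v). N (VertOut v j)) \<le>
      (\<Sum>v\<in>sh_verts ?S. (\<Sum>i<gen_in (sh_gen ?S v). N (sh_wire ?S (VertIn v i))) + gen_dim (sh_gen ?S v))"
    using vertex by (rule sum_mono)
  moreover have "(\<Sum>v\<in>sh_verts ?S. gen_dim (sh_gen ?S v)) = card (cell_verts ?S)"
  proof -
    have "gen_dim g = (if gen_dim g = 1 then 1 else 0)" for g by (cases g) auto
    then have "(\<Sum>v\<in>sh_verts ?S. gen_dim (sh_gen ?S v)) =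
        (\<Sum>v\<in>sh_verts ?S. if gen_dim (sh_gen ?S v) = 1 then 1 else 0)" by metis
    then show ?thesis using S(1) by (simp add: cell_verts_def sum.If_cases Int_def)
  qed
  \<comment> \<open>Each target is fed by exactly one source, so the two totals agree; subtracting
    the vertex inequality leaves external inputs and outputs and the dimensions.\<close>
  moreover have "(\<Sum>t\<in>targets ?S. N (sh_wire ?S t)) = sum N (sources ?S)"
    using S(2) by (rule sum.reindex_bij_betw)
  moreover have "N (ExtIn 0) = card (x ` ?K - {0, 1})"
  proof -
    have "edge_val D (\<lambda>_. x k) (ExtIn 0) = x k" for k
      using carries.ext[of 0 D "\<lambda>_. x k"] S(3) by (intro edge_val_eqI) simp
    then show ?thesis by (simp add: N_def)
  qed
  moreover have "N (sh_wire ?S (ExtOut i)) = card (apply_pt d (profile D i) x ` ?K - {0, 1})" for i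
    by (simp add: N_def apply_pt_def profile_def)
  ultimately show ?thesis
    using sum_targets[OF S(1), of "\<lambda>t. N (sh_wire ?S t)"] sum_sources[OF S(1), of N] S(3,4)
    by (simp add: sum.distrib)
qed

subsection \<open>Continuity\<close>

lemma quotient_map_quotient_topology: "quotient_map X (quotient_topology X q) q"
  unfolding quotient_map_def by (auto simp: openin_quotient_topology)

lemma continuous_map_from_sum_topology:
  assumes "\<And>i. i \<in> I \<Longrightarrow> continuous_map (X i) Y (\<lambda>x. f (i, x))"
  shows "continuous_map (sum_topology X I) Y f"
  unfolding continuous_map_def
proof (intro conjI allI impI)
  show "f \<in> topspace (sum_topology X I) \<rightarrow> topspace Y"
    using assms by (force simp: continuous_map_def)
  fix U assume U: "openin Y U"
  have "{x. (i, x) \<in> {z \<in> topspace (sum_topology X I). f z \<in> U}} = {x \<in> topspace (X i). f (i, x) \<in> U}"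
    if "i \<in> I" for i
    using that by auto
  then show "openin (sum_topology X I) {z \<in> topspace (sum_topology X I). f z \<in> U}"
    using openin_continuous_map_preimage[OF assms U] by (auto simp: openin_sum_topology)
qed

text \<open>The domain is an abstract topology, so the usual estimate is phrased through a
  continuous majorant vanishing at \<open>a\<close>; its strict sublevel sets are the
  neighbourhoods.\<close>

lemma continuous_map_dist_bound:
  fixes f :: "'a \<Rightarrow> 'b :: metric_space"
  assumes "\<And>a. a \<in> topspace X \<Longrightarrow> \<exists>h. continuous_map X euclideanreal h \<and> h a = 0 \<and>
     (\<forall>x\<in>topspace X. dist (f x) (f a) \<le> h x)"
  shows "continuous_map X euclidean f"
  unfolding continuous_map_def
proof (intro conjI allI impI)
  fix U :: "'b set" assume "openin euclidean U"
  then have U: "open U" by simp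
  show "openin X {x \<in> topspace X. f x \<in> U}"
  proof (subst openin_subopen, intro ballI)
    fix a assume a: "a \<in> {x \<in> topspace X. f x \<in> U}"
    then obtain e where e: "e > 0" "\<And>y. dist y (f a) < e \<Longrightarrow> y \<in> U"
      using U unfolding open_dist by blast
    obtain h where h: "continuous_map X euclideanreal h" "h a = 0" "\<forall>x\<in>topspace X. dist (f x) (f a) \<le> h x"
      using assms a by blast
    have "openin X {x \<in> topspace X. h x \<in> {..<e}}"
      using h(1) by (rule openin_continuous_map_preimage) simp
    moreover have "{x \<in> topspace X. h x \<in> {..<e}} \<subseteq> {x \<in> topspace X. f x \<in> U}"
      using e(2) h(3) by (auto intro: le_less_trans)
    ultimately show "\<exists>T. openin X T \<and> a \<in> T \<and> T \<subseteq> {x \<in> topspace X. f x \<in> U}"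
      using a e(1) h(2) by (intro exI[of _ "{x \<in> topspace X. h x \<in> {..<e}}"]) auto
  qed
qed simp

section \<open>Profiles as points of a function space\<close>

text \<open>Moving the function costs at most the supremum distance at any argument; moving the
  argument is continuity of the one function \<open>fst a\<close>.\<close>

lemma continuous_map_eval_bcontfun:
  "continuous_map euclidean euclidean
     (\<lambda>z :: ('a :: metric_space \<Rightarrow>\<^sub>C 'b :: metric_space) \<times> 'a. apply_bcontfun (fst z) (snd z))"
proof (rule continuous_map_dist_bound)
  fix a :: "('a \<Rightarrow>\<^sub>C 'b) \<times> 'a"
  let ?h = "\<lambda>z. dist (fst z) (fst a) + dist (apply_bcontfun (fst a) (snd z)) (apply_bcontfun (fst a) (snd a))"
  have "continuous_on UNIV ?h"
    by (intro continuous_intros continuous_on_compose2[OF continuous_on_apply_bcontfun[of UNIV]]) auto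
  moreover have "dist (apply_bcontfun (fst z) (snd z)) (apply_bcontfun (fst a) (snd a)) \<le> ?h z" for z
    using dist_triangle[of "apply_bcontfun (fst z) (snd z)" "apply_bcontfun (fst a) (snd a)"
        "apply_bcontfun (fst a) (snd z)"] dist_bounded[of "fst z" "snd z" "fst a"] by linarith
  ultimately show "\<exists>h. continuous_map euclidean euclideanreal h \<and> h a = 0 \<and>
      (\<forall>z\<in>topspace euclidean. dist (apply_bcontfun (fst z) (snd z)) (apply_bcontfun (fst a) (snd a)) \<le> h z)"
    by (intro exI[of _ ?h]) auto
qed

text \<open>Profiles, extended by constants outside of the unit interval, as points of a metric space.\<close>

definition clamp_unit :: "real \<Rightarrow> real" where
  "clamp_unit t = max 0 (min 1 t)"

lemma clamp_unit: "clamp_unit t \<in> {0..1}" "t \<in> {0..1} \<Longrightarrow> clamp_unit t = t"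
  "\<bar>clamp_unit t - clamp_unit u\<bar> \<le> \<bar>t - u\<bar>"
  by (auto simp: clamp_unit_def)

definition profile_fun :: "diagram \<Rightarrow> nat \<Rightarrow> real \<Rightarrow>\<^sub>C real" where
  "profile_fun D i = Bcontfun (\<lambda>t. profile D i (clamp_unit t))"

lemma profile_lipschitz:
  assumes S: "S \<in> shapes 1 m" and i: "i < m"
  shows "\<exists>L\<ge>0. \<forall>p\<in>params S. \<forall>p'\<in>params S. \<forall>t\<in>{0..1}. \<forall>t'\<in>{0..1}.
    \<bar>profile (S, p) i t - profile (S, p') i t'\<bar> \<le> L * (\<bar>t - t'\<bar> + (\<Sum>u\<in>cell_verts S. \<bar>p u - p' u\<bar>))"
proof -
  have S': "finite (sh_verts S)" "sh_in S = 1" "sh_out S = m" using S by (auto simp: shapes_def)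
  have D: "(S, p) \<in> diagrams 1 m" if "p \<in> params S" for p using S that by (simp add: diagrams_def)
  have c: "carries (S, p) a (sh_wire S (ExtOut i)) (out_val (S, p) a i)" if "p \<in> params S" for p a
    using carries_out_val[OF evaluable_diagram[OF D[OF that]], of i a] i S' by simp
  \<comment> \<open>The zero parameters serve only to produce a derivation reaching the output,
    which \<open>carries_imp_edge_lipschitz\<close> asks for.\<close>
  have "(\<lambda>v\<in>cell_verts S. 0) \<in> params S" by (auto simp: params_def)
  from carries_imp_edge_lipschitz[OF c[OF this] S'(1)]
  obtain L where L: "edge_lipschitz S (sh_wire S (ExtOut i)) L" by blast
  show ?thesis
  proof (intro exI[of _ L] conjI ballI)
    show "L \<ge> 0" using L by (simp add: edge_lipschitz_def)
    fix p p' and t t' :: real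
    assume *: "p \<in> params S" "p' \<in> params S" "t \<in> {0..1}" "t' \<in> {0..1}"
    have "unit_params (S, p)" "unit_params (S, p')"
      using evaluable_diagram[OF D] * by (auto simp: evaluable_def)
    from edge_lipschitzD[OF L c c this, of "\<lambda>_. t" "\<lambda>_. t'"] * S'(2)
    show "\<bar>profile (S, p) i t - profile (S, p') i t'\<bar> \<le> L * (\<bar>t - t'\<bar> + (\<Sum>u\<in>cell_verts S. \<bar>p u - p' u\<bar>))"
      by (simp add: profile_def)
  qed
qed

text \<open>\<open>Bcontfun\<close> is meaningful only on bounded continuous functions: the
  Lipschitz estimate at equal parameters gives continuity, and \<open>interval_map\<close> the bound
  1.\<close>

lemma apply_profile_fun:
  assumes "D \<in> diagrams 1 m" "i < m"
  shows "apply_bcontfun (profile_fun D i) t = profile D i (clamp_unit t)"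
proof -
  obtain S p where D: "D = (S, p)" by (cases D)
  then have S: "S \<in> shapes 1 m" "p \<in> params S" using assms(1) by (auto simp: diagrams_def)
  obtain L where L: "L \<ge> 0" "\<forall>p\<in>params S. \<forall>p'\<in>params S. \<forall>t\<in>{0..1}. \<forall>t'\<in>{0..1}.
    \<bar>profile (S, p) i t - profile (S, p') i t'\<bar> \<le> L * (\<bar>t - t'\<bar> + (\<Sum>u\<in>cell_verts S. \<bar>p u - p' u\<bar>))"
    using profile_lipschitz[OF S(1) assms(2)] by blast
  let ?f = "\<lambda>t. profile D i (clamp_unit t)"
  have "\<bar>?f t - ?f u\<bar> \<le> L * \<bar>t - u\<bar>" for t u
  proof -
    have "\<bar>?f t - ?f u\<bar> \<le> L * \<bar>clamp_unit t - clamp_unit u\<bar>"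
      using L(2)[rule_format, OF S(2) S(2) clamp_unit(1) clamp_unit(1), of t u] by (simp add: D)
    also have "\<dots> \<le> L * \<bar>t - u\<bar>" by (intro mult_left_mono L(1) clamp_unit(3))
    finally show ?thesis .
  qed
  then have "L-lipschitz_on UNIV ?f" using L(1) by (intro lipschitz_onI) (auto simp: dist_real_def)
  then have "continuous_on UNIV ?f" by (rule lipschitz_on_continuous_on)
  moreover have "interval_map (profile D i)"
    using evaluable_diagram[OF assms(1)] assms(2) S(1) by (intro interval_map_profile) (auto simp: D shapes_def)
  then have "norm (?f t) \<le> 1" for t
    using interval_map_unit[of "profile D i" "clamp_unit t"] clamp_unit(1)[of t] by auto
  ultimately have "?f \<in> bcontfun" by (intro bcontfun_normI)
  then show ?thesis by (simp add: profile_fun_def Bcontfun_inverse)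
qed

lemma interval_map_profile_fun:
  assumes "D \<in> diagrams 1 m" "i < m"
  shows "interval_map (apply_bcontfun (profile_fun D i))"
    and "t \<in> {0..1} \<Longrightarrow> apply_bcontfun (profile_fun D i) t = profile D i t"
proof -
  have eq: "apply_bcontfun (profile_fun D i) t = profile D i t" if "t \<in> {0..1}" for t
    using apply_profile_fun[OF assms] clamp_unit(2)[OF that] by simp
  then show "t \<in> {0..1} \<Longrightarrow> apply_bcontfun (profile_fun D i) t = profile D i t" .
  have "interval_map (profile D i)"
    using evaluable_diagram[OF assms(1)] assms by (intro interval_map_profile) (auto simp: diagrams_def shapes_def)
  then show "interval_map (apply_bcontfun (profile_fun D i))"
    using eq by (auto simp: interval_map_def mono_on_def)
qed

text \<open>Clamping puts every argument in the unit interval, where equivalent diagrams are known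
  to agree.\<close>

lemma profile_fun_st_eq:
  assumes "D \<in> diagrams 1 m" "E \<in> diagrams 1 m" "st_eq D E" "i < m"
  shows "profile_fun D i = profile_fun E i"
proof (rule bcontfun_eqI)
  fix t
  have "same_action D E" using assms(3) by (rule st_eq_imp_same_action)
  moreover have "sh_out (fst D) = m" using assms(1) by (auto simp: diagrams_def shapes_def)
  ultimately have "profile D i (clamp_unit t) = profile E i (clamp_unit t)"
    using assms(4) clamp_unit(1)[of t] by (simp add: same_action_def profile_def)
  then show "apply_bcontfun (profile_fun D i) t = apply_bcontfun (profile_fun E i) t"
    using assms by (simp add: apply_profile_fun)
qed

text \<open>\<open>L\<close> does not depend on the argument, so the estimate at equal arguments
  bounds the supremum distance of two profiles.\<close>

lemma continuous_profile_fun: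
  assumes S: "S \<in> shapes 1 m" and i: "i < m"
  shows "continuous_map (subtopology (powertop_real (cell_verts S)) (params S)) euclidean (\<lambda>p. profile_fun (S, p) i)"
proof (rule continuous_map_dist_bound)
  let ?X = "subtopology (powertop_real (cell_verts S)) (params S)"
  fix p assume "p \<in> topspace ?X"
  then have p: "p \<in> params S" by simp
  obtain L where L: "L \<ge> 0" "\<forall>p\<in>params S. \<forall>p'\<in>params S. \<forall>t\<in>{0..1}. \<forall>t'\<in>{0..1}.
    \<bar>profile (S, p) i t - profile (S, p') i t'\<bar> \<le> L * (\<bar>t - t'\<bar> + (\<Sum>u\<in>cell_verts S. \<bar>p u - p' u\<bar>))"
    using profile_lipschitz[OF S i] by blast
  let ?h = "\<lambda>q. L * (\<Sum>u\<in>cell_verts S. \<bar>q u - p u\<bar>)"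
  have fin: "finite (cell_verts S)" using S by (simp add: shapes_def cell_verts_def)
  have "continuous_map (powertop_real (cell_verts S)) euclideanreal ?h"
    using fin by (intro continuous_intros continuous_map_product_projection) auto
  then have "continuous_map ?X euclideanreal ?h" by (rule continuous_map_from_subtopology)
  moreover have "dist (profile_fun (S, q) i) (profile_fun (S, p) i) \<le> ?h q" if q: "q \<in> topspace ?X" for q
  proof (rule dist_bound)
    fix t
    have q: "q \<in> params S" using q by simp
    then have "(S, q) \<in> diagrams 1 m" "(S, p) \<in> diagrams 1 m" using S p by (auto simp: diagrams_def)
    then show "dist (profile_fun (S, q) i t) (profile_fun (S, p) i t) \<le> ?h q"
      using L(2)[rule_format, OF q p clamp_unit(1) clamp_unit(1), of t t] i by (simp add: apply_profile_fun dist_real_def)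
  qed
  ultimately show "\<exists>h. continuous_map ?X euclideanreal h \<and> h p = 0 \<and>
      (\<forall>q\<in>topspace ?X. dist (profile_fun (S, q) i) (profile_fun (S, p) i) \<le> h q)"
    by (intro exI[of _ ?h]) auto
qed

text \<open>The representative is chosen within \<open>diagrams 1 m\<close>, where
  \<open>profile_fun_st_eq\<close> makes the result independent of the choice.\<close>

definition class_profile :: "nat \<Rightarrow> diagram set \<Rightarrow> nat \<Rightarrow> real \<Rightarrow>\<^sub>C real" where
  "class_profile m g i = profile_fun (SOME D. D \<in> diagrams 1 m \<and> st_class D = g) i"

lemma class_profile_st_class:
  assumes "D \<in> diagrams 1 m" "i < m"
  shows "class_profile m (st_class D) i = profile_fun D i"
proof -
  define E where "E = (SOME E. E \<in> diagrams 1 m \<and> st_class E = st_class D)"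
  have E: "E \<in> diagrams 1 m \<and> st_class E = st_class D"
    unfolding E_def by (rule someI[of _ D]) (use assms in simp)
  then have "D \<in> st_class E" using st_class_refl[OF st_eq_refl[OF assms(1)]] by simp
  then have "st_eq E D" by (simp add: st_class_def)
  then have "profile_fun E i = profile_fun D i" using E assms by (intro profile_fun_st_eq[of _ m]) auto
  then show ?thesis by (simp add: class_profile_def E_def)
qed

lemma continuous_class_profile:
  assumes "i < m"
  shows "continuous_map (cw_top (osp (U_operad St) m)) euclidean (\<lambda>g. class_profile m g i)"
proof -
  let ?X = "\<lambda>S. subtopology (powertop_real (cell_verts S)) (params S)"
  have "continuous_map (sum_topology ?X (shapes 1 m)) euclidean ((\<lambda>g. class_profile m g i) \<circ> st_class)"
  proof (rule continuous_map_from_sum_topology)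
    fix S assume S: "S \<in> shapes 1 m"
    have "(S, p) \<in> diagrams 1 m" if "p \<in> topspace (?X S)" for p
      using S that by (simp add: diagrams_def)
    then show "continuous_map (?X S) euclidean (\<lambda>p. ((\<lambda>g. class_profile m g i) \<circ> st_class) (S, p))"
      using continuous_profile_fun[OF S assms] assms
      by (elim continuous_map_eq) (simp add: class_profile_st_class)
  qed
  then show ?thesis
    using continuous_compose_quotient_map[OF quotient_map_quotient_topology]
    by (simp add: U_operad_def St_def st_hom_def)
qed

lemma continuous_apply_pt:
  assumes "\<And>b. b \<in> K \<Longrightarrow> interval_map (apply_bcontfun b)"
  shows "continuous_map (prod_topology (subtopology euclidean K) (cw_top (simplex_cw d))) (cw_top (simplex_cw d))
           (\<lambda>(b, x). apply_pt d (apply_bcontfun b) x)"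
proof -
  let ?P = "prod_topology (subtopology euclidean K) (cw_top (simplex_cw d))"
  have "continuous_map ?P euclideanreal (\<lambda>z. apply_bcontfun (fst z) (snd z k))" if k: "k \<in> {1..d}" for k
  proof -
    have 1: "continuous_map ?P euclidean fst"
      using continuous_map_fst continuous_map_into_fulltopology by blast
    have "continuous_map (cw_top (simplex_cw d)) euclideanreal (\<lambda>x. x k)"
      unfolding simplex_cw_def using k by (auto intro!: continuous_map_from_subtopology continuous_map_product_projection)
    from continuous_map_compose[OF continuous_map_snd this]
    have 2: "continuous_map ?P euclideanreal (\<lambda>z. snd z k)" by (simp add: o_def)
    from continuous_map_pairedI[OF 1 2]
    have "continuous_map ?P euclidean (\<lambda>z. (fst z, snd z k))" by simp
    from continuous_map_compose[OF this continuous_map_eval_bcontfun]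
    show ?thesis by (simp add: o_def)
  qed
  then have "continuous_map ?P (powertop_real {1..d}) (\<lambda>(b, x). apply_pt d (apply_bcontfun b) x)"
    by (auto simp: continuous_map_componentwise apply_pt_def case_prod_unfold)
  moreover have "(\<lambda>(b, x). apply_pt d (apply_bcontfun b) x) \<in> topspace ?P \<rightarrow> simplex_pts d"
    using assms by (auto simp: topspace_simplex intro: apply_pt_in_simplex)
  ultimately show ?thesis
    by (simp add: simplex_cw_def continuous_map_in_subtopology)
qed

section \<open>Joint continuity of the action on the realization\<close>

definition gpoint_topology :: "'g sset \<Rightarrow> 'g gpoint topology" where
  "gpoint_topology \<Gamma> = sum_topology (\<lambda>(d, \<gamma>). cw_top (simplex_cw d)) (SIGMA d:UNIV. s_cells \<Gamma> d)"

lemma topspace_gpoint_topology: "topspace (gpoint_topology \<Gamma>) = gpoints \<Gamma>"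
  by (auto simp: gpoint_topology_def gpoints_def topspace_simplex)

lemma quotient_map_geom_class: "quotient_map (gpoint_topology \<Gamma>) (cw_top (geom \<Gamma>)) (geom_class \<Gamma>)"
  using quotient_map_quotient_topology by (simp add: geom_def gpoint_topology_def)

text \<open>The product with a disjoint union is treated pointwise: a point lies in one summand,
  where \<open>continuous_apply_pt\<close> gives a rectangular neighbourhood, and the injection of
  the summand is open.\<close>

lemma continuous_lift_pt:
  fixes K :: "(real \<Rightarrow>\<^sub>C real) set"
  assumes K: "\<And>b. b \<in> K \<Longrightarrow> interval_map (apply_bcontfun b)"
  shows "continuous_map (prod_topology (subtopology euclidean K) (gpoint_topology \<Gamma>)) (gpoint_topology \<Gamma>)
           (\<lambda>(b, a). lift_pt (apply_bcontfun b) a)"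
  unfolding continuous_map_def
proof (intro conjI allI impI)
  let ?Z = "subtopology euclidean K" and ?A = "gpoint_topology \<Gamma>"
  show "(\<lambda>(b, a). lift_pt (apply_bcontfun b) a) \<in> topspace (prod_topology ?Z ?A) \<rightarrow> topspace ?A"
    using K by (auto simp: topspace_gpoint_topology intro: lift_pt_gpoints)
  fix U assume U: "openin ?A U"
  let ?W = "{z \<in> topspace (prod_topology ?Z ?A). (\<lambda>(b, a). lift_pt (apply_bcontfun b) a) z \<in> U}"
  show "openin (prod_topology ?Z ?A) ?W"
    unfolding openin_prod_topology_alt
  proof (intro allI impI)
    fix b a assume "(b, a) \<in> ?W"
    then obtain d \<gamma> x where a: "a = ((d, \<gamma>), x)" "\<gamma> \<in> s_cells \<Gamma> d" "x \<in> simplex_pts d"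
      and b: "b \<in> K" and inU: "((d, \<gamma>), apply_pt d (apply_bcontfun b) x) \<in> U"
      by (auto simp: topspace_gpoint_topology gpoints_def)
    define U' where "U' = {y. ((d, \<gamma>), y) \<in> U}"
    have "(d, \<gamma>) \<in> (SIGMA d:UNIV. s_cells \<Gamma> d)" using a(2) by simp
    with U have "openin (case (d, \<gamma>) of (d, \<gamma>) \<Rightarrow> cw_top (simplex_cw d)) {y. ((d, \<gamma>), y) \<in> U}"
      unfolding gpoint_topology_def openin_sum_topology by blast
    then have U': "openin (cw_top (simplex_cw d)) U'" by (simp add: U'_def)
    define Q where "Q = {z \<in> topspace (prod_topology ?Z (cw_top (simplex_cw d))).
        (\<lambda>(b, x). apply_pt d (apply_bcontfun b) x) z \<in> U'}"
    have Q: "openin (prod_topology ?Z (cw_top (simplex_cw d))) Q"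
      unfolding Q_def by (rule openin_continuous_map_preimage[OF continuous_apply_pt[OF K] U'])
    have "(b, x) \<in> Q" using a b inU by (simp add: topspace_simplex U'_def Q_def)
    from Q[unfolded openin_prod_topology_alt, rule_format, OF this]
    obtain V V' where V: "openin ?Z V" "openin (cw_top (simplex_cw d)) V'" "b \<in> V" "x \<in> V'" "V \<times> V' \<subseteq> Q"
      by blast
    have "openin ?A (Pair (d, \<gamma>) ` V')"
    proof -
      have "open_map (cw_top (simplex_cw d)) ?A (Pair (d, \<gamma>))"
        using open_map_component_injection[of "(d, \<gamma>)" "SIGMA d:UNIV. s_cells \<Gamma> d" "\<lambda>(d, \<gamma>). cw_top (simplex_cw d)"] a(2)
        by (simp add: gpoint_topology_def)
      then show ?thesis using V(2) by (simp add: open_map_def)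
    qed
    moreover have "V \<times> Pair (d, \<gamma>) ` V' \<subseteq> ?W"
      using V(5) a(2) by (auto simp: topspace_gpoint_topology gpoints_def topspace_simplex U'_def Q_def)
    ultimately show "\<exists>V V'. openin ?Z V \<and> openin ?A V' \<and> b \<in> V \<and> a \<in> V' \<and> V \<times> V' \<subseteq> ?W"
      using V(1,3,4) a(1) by (intro exI[of _ V] exI[of _ "Pair (d, \<gamma>) ` V'"]) auto
  qed
qed

text \<open>The operation with the hom-space replaced by the space of profiles; the chosen
  representative is immaterial when \<open>b\<close> is an interval map.\<close>

definition class_action :: "'g sset \<Rightarrow> (real \<Rightarrow>\<^sub>C real) \<Rightarrow> 'g gpoint set \<Rightarrow> 'g gpoint set" where
  "class_action \<Gamma> b c = geom_class \<Gamma> (lift_pt (apply_bcontfun b) (SOME a. geom_class \<Gamma> a = c))"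

lemma class_action_geom_class:
  assumes "interval_map (apply_bcontfun b)"
  shows "class_action \<Gamma> b (geom_class \<Gamma> a) = geom_class \<Gamma> (lift_pt (apply_bcontfun b) a)"
proof -
  have "geom_class \<Gamma> (SOME a'. geom_class \<Gamma> a' = geom_class \<Gamma> a) = geom_class \<Gamma> a"
    by (rule someI[of _ a]) simp
  then show ?thesis unfolding class_action_def by (intro geom_class_lift_pt assms)
qed

text \<open>Whitehead's theorem on products with a locally compact factor applies since \<open>K\<close> is compact
  and metrizable.\<close>

lemma continuous_class_action:
  fixes K :: "(real \<Rightarrow>\<^sub>C real) set"
  assumes "compact K" and K: "\<And>b. b \<in> K \<Longrightarrow> interval_map (apply_bcontfun b)"
  shows "continuous_map (prod_topology (subtopology euclidean K) (cw_top (geom \<Gamma>))) (cw_top (geom \<Gamma>))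
           (\<lambda>(b, c). class_action \<Gamma> b c)"
proof -
  let ?Z = "subtopology euclidean K" and ?A = "gpoint_topology \<Gamma>"
  have "locally_compact_space ?Z"
    using assms(1) by (intro compact_imp_locally_compact_space compact_space_subtopology) simp
  moreover have "Hausdorff_space ?Z" by (intro Hausdorff_space_subtopology Hausdorff_space_euclidean)
  ultimately have quot: "quotient_map (prod_topology ?Z ?A) (prod_topology ?Z (cw_top (geom \<Gamma>)))
      (\<lambda>(b, a). (b, geom_class \<Gamma> a))"
    by (intro quotient_map_prod_right quotient_map_geom_class) auto
  have "continuous_map (prod_topology ?Z ?A) (cw_top (geom \<Gamma>)) (geom_class \<Gamma> \<circ> (\<lambda>(b, a). lift_pt (apply_bcontfun b) a))"
    by (intro continuous_map_compose[OF continuous_lift_pt[OF K]] quotient_imp_continuous_map quotient_map_geom_class)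
  then have "continuous_map (prod_topology ?Z ?A) (cw_top (geom \<Gamma>))
      ((\<lambda>(b, c). class_action \<Gamma> b c) \<circ> (\<lambda>(b, a). (b, geom_class \<Gamma> a)))"
    by (rule continuous_map_eq) (auto simp: class_action_geom_class K)
  then show ?thesis by (rule continuous_compose_quotient_map[OF quot])
qed

text \<open>Factorization through the space of profiles. The second conclusion shows that only
  interval maps occur, as \<open>continuous_class_action\<close> requires.\<close>

lemma U_Phi_class_action:
  assumes \<Gamma>: "simplicial_set \<Gamma>" and g: "g \<in> cw_points (osp (U_operad St) m)"
    and c: "c \<in> cw_points (geom \<Gamma>)" and i: "i < m"
  shows "U_Phi \<Gamma> m g c i = class_action \<Gamma> (class_profile m g i) c"
    and "interval_map (apply_bcontfun (class_profile m g i))"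
proof -
  obtain D where D: "D \<in> diagrams 1 m" "g = st_class D" "st_eq D D" "sh_in (fst D) = 1" "sh_out (fst D) = m"
    using g by (rule osp_pointE)
  obtain a where a: "a \<in> gpoints \<Gamma>" "c = geom_class \<Gamma> a" using c by (rule geom_pointE)
  have p: "class_profile m g i = profile_fun D i" unfolding D(2) using D(1) i by (rule class_profile_st_class)
  then show int: "interval_map (apply_bcontfun (class_profile m g i))"
    using interval_map_profile_fun(1)[OF D(1) i] by simp
  have "lift_pt (apply_bcontfun (class_profile m g i)) a = lift_pt (profile D i) a"
  proof -
    obtain d \<gamma> x where x: "a = ((d, \<gamma>), x)" "x \<in> simplex_pts d" using a(1) by (auto simp: gpoints_def)
    have "apply_bcontfun (profile_fun D i) (x k) = profile D i (x k)" if "k \<in> {1..d}" for k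
      using interval_map_profile_fun(2)[OF D(1) i] x(2) that by (simp add: simplex_pts_iff del: atLeastAtMost_iff)
    then show ?thesis by (auto simp: x(1) p apply_pt_def intro!: restrict_ext)
  qed
  then show "U_Phi \<Gamma> m g c i = class_action \<Gamma> (class_profile m g i) c"
    using U_Phi_geom_class[OF \<Gamma> D(3,4) a(1)] i class_action_geom_class[OF int, of \<Gamma> a]
    unfolding D(2,5) a(2) by simp
qed

lemma continuous_U_Phi_component:
  assumes \<Gamma>: "simplicial_set \<Gamma>" and i: "i < m"
  shows "continuous_map (kification (prod_topology (cw_top (osp (U_operad St) m)) (cw_top (geom \<Gamma>))))
           (cw_top (geom \<Gamma>)) (\<lambda>(g, c). U_Phi \<Gamma> m g c i)"
proof -
  let ?P = "cw_top (osp (U_operad St) m)" and ?G = "cw_top (geom \<Gamma>)"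
  let ?f = "\<lambda>(g, c). U_Phi \<Gamma> m g c i"
  have cont: "continuous_map (subtopology (prod_topology ?P ?G) C) ?G ?f" if C: "compactin (prod_topology ?P ?G) C" for C
  proof -
    \<comment> \<open>Only the profiles of first components of \<open>C\<close> matter, and they
      form a compact set; this makes \<open>continuous_class_action\<close> applicable even if the
      hom-space is not locally compact.\<close>
    define K where "K = (\<lambda>g. class_profile m g i) ` fst ` C"
    have "compactin ?P (fst ` C)" using C continuous_map_fst by (rule image_compactin)
    then have "compactin euclidean K"
      unfolding K_def using continuous_class_profile[OF i] by (rule image_compactin)
    then have K: "compact K" by simp
    have C': "C \<subseteq> topspace ?P \<times> topspace ?G" using compactin_subset_topspace[OF C] by simp
    have interval: "interval_map (apply_bcontfun b)" if b: "b \<in> K" for b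
    proof -
      obtain g c where "(g, c) \<in> C" "b = class_profile m g i" using b by (auto simp: K_def)
      then show ?thesis using U_Phi_class_action(2)[OF \<Gamma> _ _ i] C' by blast
    qed
    let ?C = "subtopology (prod_topology ?P ?G) C"
    have "continuous_map ?C ?P fst" "continuous_map ?C ?G snd"
      by (intro continuous_map_from_subtopology continuous_map_fst continuous_map_snd)+
    moreover from continuous_map_compose[OF this(1) continuous_class_profile[OF i]]
    have "continuous_map ?C (subtopology euclidean K) (\<lambda>z. class_profile m (fst z) i)"
      by (auto simp: o_def continuous_map_in_subtopology K_def)
    ultimately have "continuous_map ?C (prod_topology (subtopology euclidean K) ?G) (\<lambda>z. (class_profile m (fst z) i, snd z))"
      by (intro continuous_map_pairedI)
    from continuous_map_compose[OF this continuous_class_action[OF K interval]]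
    have "continuous_map ?C ?G (\<lambda>z. class_action \<Gamma> (class_profile m (fst z) i) (snd z))" by (simp add: o_def)
    then show ?thesis
      by (rule continuous_map_eq) (auto simp: U_Phi_class_action(1)[OF \<Gamma> _ _ i])
  qed
  show ?thesis
    unfolding continuous_map_def topspace_kification
  proof (intro conjI allI impI)
    have "U_Phi \<Gamma> m g c i \<in> topspace ?G" if "g \<in> topspace ?P" "c \<in> topspace ?G" for g c
    proof -
      \<comment> \<open>A singleton is compact, so continuity on compact sets already yields
        membership in the codomain.\<close>
      have "compactin (prod_topology ?P ?G) {(g, c)}" using that by simp
      from continuous_map_image_subset_topspace[OF cont[OF this]] show ?thesis using that by simp
    qed
    then show "?f \<in> topspace (prod_topology ?P ?G) \<rightarrow> topspace ?G" by auto
    fix U assume U: "openin ?G U"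
    have "openin (subtopology (prod_topology ?P ?G) C) (C \<inter> {z \<in> topspace (prod_topology ?P ?G). ?f z \<in> U})"
      if C: "compactin (prod_topology ?P ?G) C" for C
    proof -
      have "C \<inter> {z \<in> topspace (prod_topology ?P ?G). ?f z \<in> U} =
          {z \<in> topspace (subtopology (prod_topology ?P ?G) C). ?f z \<in> U}" by auto
      then show ?thesis using openin_continuous_map_preimage[OF cont[OF C] U] by simp
    qed
    then show "openin (kification (prod_topology ?P ?G)) {z \<in> topspace (prod_topology ?P ?G). ?f z \<in> U}"
      unfolding openin_kification by blast
  qed
qed

lemma cw_map_U_Phi:
  assumes \<Gamma>: "simplicial_set \<Gamma>"
  shows "cw_map (cw_prod (osp (U_operad St) m) (geom \<Gamma>)) (cw_power (geom \<Gamma>) m) (\<lambda>(g, x). U_Phi \<Gamma> m g x)"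
  unfolding cw_map_def
proof (intro conjI allI)
  let ?PG = "prod_topology (cw_top (osp (U_operad St) m)) (cw_top (geom \<Gamma>))"
  have "U_Phi \<Gamma> m g c \<in> extensional {..<m}"
    if g: "g \<in> cw_points (osp (U_operad St) m)" and c: "c \<in> cw_points (geom \<Gamma>)" for g c
  proof -
    obtain D where D: "g = st_class D" "st_eq D D" "sh_in (fst D) = 1" "sh_out (fst D) = m"
      using g by (rule osp_pointE)
    obtain a where a: "a \<in> gpoints \<Gamma>" "c = geom_class \<Gamma> a" using c by (rule geom_pointE)
    show ?thesis using U_Phi_geom_class[OF \<Gamma> D(2,3) a(1)] unfolding D(1,4) a(2) by simp
  qed
  then have "continuous_map (kification ?PG) (product_topology (\<lambda>_. cw_top (geom \<Gamma>)) {..<m}) (\<lambda>(g, x). U_Phi \<Gamma> m g x)"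
    using continuous_U_Phi_component[OF \<Gamma>] by (auto simp: continuous_map_componentwise case_prod_unfold)
  then show "continuous_map (cw_top (cw_prod (osp (U_operad St) m) (geom \<Gamma>))) (cw_top (cw_power (geom \<Gamma>) m))
      (\<lambda>(g, x). U_Phi \<Gamma> m g x)"
    \<comment> \<open>The source is k-ified, hence a k-space, so continuity into the plain product
      amounts to continuity into its k-ification.\<close>
    by (simp add: cw_prod_def cw_power_def continuous_map_into_kification)
next
  fix k
  show "(\<lambda>(g, x). U_Phi \<Gamma> m g x) ` cw_skel (cw_prod (osp (U_operad St) m) (geom \<Gamma>)) k \<subseteq> cw_skel (cw_power (geom \<Gamma>) m) k"
  proof clarify
    fix g c assume "(g, c) \<in> cw_skel (cw_prod (osp (U_operad St) m) (geom \<Gamma>)) k"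
    then obtain i where i: "i \<le> k" "g \<in> cw_skel (osp (U_operad St) m) i" "c \<in> cw_skel (geom \<Gamma>) (k - i)"
      by (auto simp: cw_prod_def)
    obtain D where D: "D \<in> diagrams 1 m" "g = st_class D" "card (cell_verts (fst D)) \<le> i"
      using i(2) by (auto simp: U_operad_def St_def st_hom_def)
    then have D': "st_eq D D" "sh_in (fst D) = 1" "sh_out (fst D) = m"
      by (auto intro: st_eq_refl simp: diagrams_def shapes_def)
    obtain d \<gamma> x where x: "c = geom_class \<Gamma> ((d, \<gamma>), x)" "\<gamma> \<in> s_cells \<Gamma> d" "x \<in> simplex_pts d"
      "card (x ` {1..d} - {0, 1}) \<le> k - i"
      using i(3) by (auto simp: geom_def simplex_cw_def)
    \<comment> \<open>\<open>n\<close> distributes the skeletal degrees over the factors as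
      \<open>cw_power\<close> demands; its sum is at most (k - i) + i.\<close>
    define n where "n j = card (apply_pt d (profile D j) x ` {1..d} - {0, 1})" for j
    have "(\<Sum>j<m. n j) \<le> k"
      using sum_card_interior_profile[OF D(1) x(3)] D(3) x(4) i(1) by (simp add: n_def)
    moreover have "U_Phi \<Gamma> m g c = (\<lambda>j\<in>{..<m}. geom_class \<Gamma> ((d, \<gamma>), apply_pt d (profile D j) x))"
      using U_Phi_geom_class[OF \<Gamma> D'(1,2), of "((d, \<gamma>), x)"] x unfolding D(2) D'(3) by (simp add: gpoints_def)
    moreover have "geom_class \<Gamma> ((d, \<gamma>), apply_pt d (profile D j) x) \<in> cw_skel (geom \<Gamma>) (n j)" if "j < m" for j
    proof -
      have "interval_map (profile D j)"
        using st_eq_evaluable[OF D'(1)] that D'(3) by (intro interval_map_profile) auto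
      then have "apply_pt d (profile D j) x \<in> simplex_pts d" using x(3) by (rule apply_pt_in_simplex)
      then show ?thesis using x(2) by (auto simp: geom_def simplex_cw_def n_def)
    qed
    ultimately show "U_Phi \<Gamma> m g c \<in> cw_skel (cw_power (geom \<Gamma>) m) k"
      by (auto simp: cw_power_def intro!: exI[of _ n])
  qed
qed

theorem theorem9:
  fixes \<Gamma> :: "'g sset"
  assumes "simplicial_set \<Gamma>"
  shows "(\<forall>m. \<forall>g \<in> cw_points (osp (U_operad St) m). \<forall>d. \<forall>\<gamma> \<in> s_cells \<Gamma> d. \<forall>x \<in> simplex_pts d.
            U_Phi \<Gamma> m g (geom_class \<Gamma> ((d, \<gamma>), x))
              = (\<lambda>i\<in>{..<m}. geom_class \<Gamma> ((d, \<gamma>), Phi d g (\<lambda>j\<in>{..<1}. x) i)))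
       \<and> coalgebra (U_operad St) (geom \<Gamma>) (U_Phi \<Gamma>)
       \<and> (\<forall>(\<Gamma>' :: 'h sset) F. simplicial_set \<Gamma>' \<longrightarrow> simplicial_map \<Gamma> \<Gamma>' F \<longrightarrow>
            (\<forall>m. \<forall>g \<in> cw_points (osp (U_operad St) m). \<forall>c \<in> cw_points (geom \<Gamma>).
               U_Phi \<Gamma>' m g (geom_map \<Gamma>' F c)
                 = (\<lambda>i\<in>{..<m}. geom_map \<Gamma>' F (U_Phi \<Gamma> m g c i))))"
proof (intro conjI allI ballI impI)
  show "coalgebra (U_operad St) (geom \<Gamma>) (U_Phi \<Gamma>)"
    unfolding coalgebra_def
  proof (intro conjI allI ballI impI)
    show "cw_map (cw_prod (osp (U_operad St) m) (geom \<Gamma>)) (cw_power (geom \<Gamma>) m) (\<lambda>(g, x). U_Phi \<Gamma> m g x)" for m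
      using assms by (rule cw_map_U_Phi)
  qed (rule U_Phi_assoc[OF assms] U_Phi_equivariant[OF assms] U_Phi_unit[OF assms]; assumption)+
qed (rule U_Phi_Phi[OF assms] U_Phi_natural[OF assms]; assumption)+

end
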